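(* Uniform perpendiculars can be constructed in intuitionistic Tarski geometry, using two-point line-circle continuity: intuitionistic Tarski geometry (which includes two-point line-circle continuity) proves that for all points $a,b,x$ with $a\neq b$ (with no case distinction as to whether $x$ lies on $\mathrm{Line}(a,b)$ or not) there exists a line (given by two distinct points) that passes through $x$ and is perpendicular to $\mathrm{Line}(a,b)$.
   Context: Language: one sort (points), equality, strict betweenness $B(a,b,c)$, congruence $E(a,b,c,d)$ written $ab=cd$. Abbreviations: $T(a,b,c):=\neg(a\neq b\land b\neq c\land\neg B(a,b,c))$; $Col(a,b,c):=\neg(\neg T(c,a,b)\land\neg T(a,c,b)\land\neg T(a,b,c))$. For $a\ne b$, "$x$ lies on $\mathrm{Line}(a,b)$" means $Col(a,b,x)$. Perpendicularity: $abc$ is a right angle ($a\neq b$, $b\neq c$), written $ab\perp bc$, if for $d$ with $B(d,b,c)$ and $db=bc$ we have $ad=ac$. Lines $K$ and $L$ are perpendicular at $f$ if $f$ lies on both and there are points $k\ne f$ on $K$ and $l\ne f$ on $L$ with $kf\perp fl$; they are perpendicular if they are perpendicular at some point $f$. Intuitionistic Tarski geometry (intuitionistic predicate logic with equality) has the universally closed axioms: (A1) $ab=ba$; (A2) $ab=pq\land ab=rs\to pq=rs$; (A3) $ab=cc\to a=b$; (A4-i) $q\neq a\to\exists x(T(q,a,x)\land ax=bc)$; (A5) $a\neq b\land T(a,b,c)\land T(A,B,C)\land ab=AB\land bc=BC\land ad=AD\land bd=BD\to cd=CD$; (A6-i) $\neg B(a,b,a)$; (A7-i) $B(a,p,c)\land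 T(b,q,c)\land\neg Col(a,b,c)\to\exists x(T(p,x,b)\land T(q,x,a))$; (A8) $\exists a,b,c\,\neg Col(a,b,c)$; (A9) $a\neq b\land pa=pb\land qa=qb\land ra=rb\to Col(p,q,r)$; (A10$_3$) $\neg Col(a,b,c)\to\exists x(ax=bx\land ax=cx)$; (A14-i) $B(a,b,c)\to B(c,b,a)$; (A15-i) $B(a,b,d)\land B(b,c,d)\to B(a,b,c)$; two-point line-circle: $Col(u,v,p)\land u\neq v\land T(a,p,b)\to\exists y,z(Col(u,v,y)\land Col(u,v,z)\land ay=ab\land az=ab\land T(y,p,z)\land(p\neq b\to y\neq z))$; stability: $\neg\neg B(a,b,c)\to B(a,b,c)$, $\neg\neg ab=cd\to ab=cd$, $\neg a\neq b\to a=b$. *)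

theory Defs
  imports Main
begin

(* Intuitionistic provability is a deep embedding: HOL's own connectives are classical.
   The language has no function symbols, so terms are variables. Variables are de Bruijn
   indices: under a quantifier 0 is the bound variable and an outer variable n becomes n + 1;
   indices pointing beyond all enclosing quantifiers are free variables. *)

datatype fm =
    Bot  ("\<^bold>\<bottom>")
  | Eq nat nat  (infix "\<^bold>=" 60)
  | Btw nat nat nat
  | Cong nat nat nat nat
  | And fm fm  (infixr "\<^bold>\<and>" 45)
  | Or fm fm  (infixr "\<^bold>\<or>" 40)
  | Imp fm fm  (infixr "\<^bold>\<longrightarrow>" 35)
  | All fm
  | Ex fm

definition Neg :: "fm \<Rightarrow> fm"  ("\<^bold>\<not> _" [50] 50) where
  "Neg \<phi> = (\<phi> \<^bold>\<longrightarrow> \<^bold>\<bottom>)"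

definition Neq :: "nat \<Rightarrow> nat \<Rightarrow> fm"  (infix "\<^bold>\<noteq>" 60) where
  "a \<^bold>\<noteq> b = (\<^bold>\<not> (a \<^bold>= b))"

definition under :: "(nat \<Rightarrow> nat) \<Rightarrow> nat \<Rightarrow> nat" where
  "under f = case_nat 0 (\<lambda>n. Suc (f n))"

primrec ren :: "(nat \<Rightarrow> nat) \<Rightarrow> fm \<Rightarrow> fm" where
  "ren f \<^bold>\<bottom> = \<^bold>\<bottom>"
| "ren f (a \<^bold>= b) = (f a \<^bold>= f b)"
| "ren f (Btw a b c) = Btw (f a) (f b) (f c)"
| "ren f (Cong a b c d) = Cong (f a) (f b) (f c) (f d)"
| "ren f (\<phi> \<^bold>\<and> \<psi>) = (ren f \<phi> \<^bold>\<and> ren f \<psi>)"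
| "ren f (\<phi> \<^bold>\<or> \<psi>) = (ren f \<phi> \<^bold>\<or> ren f \<psi>)"
| "ren f (\<phi> \<^bold>\<longrightarrow> \<psi>) = (ren f \<phi> \<^bold>\<longrightarrow> ren f \<psi>)"
| "ren f (All \<phi>) = All (ren (under f) \<phi>)"
| "ren f (Ex \<phi>) = Ex (ren (under f) \<phi>)"

(* The body of a quantifier with its bound variable replaced by t. *)
definition inst :: "fm \<Rightarrow> nat \<Rightarrow> fm" where
  "inst \<phi> t = ren (case_nat t (\<lambda>n. n)) \<phi>"

(* Natural deduction for intuitionistic predicate logic with equality. Renaming by Suc in AllI
   and ExE frees the index 0, which plays the role of the eigenvariable. *)
inductive derives :: "fm set \<Rightarrow> fm \<Rightarrow> bool"  (infix "\<turnstile>" 25) where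
  Assm: "\<phi> \<in> \<Gamma> \<Longrightarrow> \<Gamma> \<turnstile> \<phi>"
| BotE: "\<Gamma> \<turnstile> \<^bold>\<bottom> \<Longrightarrow> \<Gamma> \<turnstile> \<phi>"
| AndI: "\<Gamma> \<turnstile> \<phi> \<Longrightarrow> \<Gamma> \<turnstile> \<psi> \<Longrightarrow> \<Gamma> \<turnstile> \<phi> \<^bold>\<and> \<psi>"
| AndE1: "\<Gamma> \<turnstile> \<phi> \<^bold>\<and> \<psi> \<Longrightarrow> \<Gamma> \<turnstile> \<phi>"
| AndE2: "\<Gamma> \<turnstile> \<phi> \<^bold>\<and> \<psi> \<Longrightarrow> \<Gamma> \<turnstile> \<psi>"
| OrI1: "\<Gamma> \<turnstile> \<phi> \<Longrightarrow> \<Gamma> \<turnstile> \<phi> \<^bold>\<or> \<psi>"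
| OrI2: "\<Gamma> \<turnstile> \<psi> \<Longrightarrow> \<Gamma> \<turnstile> \<phi> \<^bold>\<or> \<psi>"
| OrE: "\<Gamma> \<turnstile> \<phi> \<^bold>\<or> \<psi> \<Longrightarrow> insert \<phi> \<Gamma> \<turnstile> \<chi> \<Longrightarrow> insert \<psi> \<Gamma> \<turnstile> \<chi> \<Longrightarrow> \<Gamma> \<turnstile> \<chi>"
| ImpI: "insert \<phi> \<Gamma> \<turnstile> \<psi> \<Longrightarrow> \<Gamma> \<turnstile> \<phi> \<^bold>\<longrightarrow> \<psi>"
| ImpE: "\<Gamma> \<turnstile> \<phi> \<^bold>\<longrightarrow> \<psi> \<Longrightarrow> \<Gamma> \<turnstile> \<phi> \<Longrightarrow> \<Gamma> \<turnstile> \<psi>"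
| AllI: "ren Suc ` \<Gamma> \<turnstile> \<phi> \<Longrightarrow> \<Gamma> \<turnstile> All \<phi>"
| AllE: "\<Gamma> \<turnstile> All \<phi> \<Longrightarrow> \<Gamma> \<turnstile> inst \<phi> t"
| ExI: "\<Gamma> \<turnstile> inst \<phi> t \<Longrightarrow> \<Gamma> \<turnstile> Ex \<phi>"
| ExE: "\<Gamma> \<turnstile> Ex \<phi> \<Longrightarrow> insert \<phi> (ren Suc ` \<Gamma>) \<turnstile> ren Suc \<chi> \<Longrightarrow> \<Gamma> \<turnstile> \<chi>"
| EqI: "\<Gamma> \<turnstile> a \<^bold>= a"
| EqE: "\<Gamma> \<turnstile> a \<^bold>= b \<Longrightarrow> \<Gamma> \<turnstile> inst \<phi> a \<Longrightarrow> \<Gamma> \<turnstile> inst \<phi> b"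

definition T :: "nat \<Rightarrow> nat \<Rightarrow> nat \<Rightarrow> fm" where
  "T a b c = (\<^bold>\<not> (a \<^bold>\<noteq> b \<^bold>\<and> b \<^bold>\<noteq> c \<^bold>\<and> \<^bold>\<not> Btw a b c))"

definition Col :: "nat \<Rightarrow> nat \<Rightarrow> nat \<Rightarrow> fm" where
  "Col a b c = (\<^bold>\<not> (\<^bold>\<not> T c a b \<^bold>\<and> \<^bold>\<not> T a c b \<^bold>\<and> \<^bold>\<not> T a b c))"

definition Right :: "nat \<Rightarrow> nat \<Rightarrow> nat \<Rightarrow> fm" where
  "Right a b c = (a \<^bold>\<noteq> b \<^bold>\<and> b \<^bold>\<noteq> c \<^bold>\<and>
     All (Btw 0 (b+1) (c+1) \<^bold>\<and> Cong 0 (b+1) (b+1) (c+1) \<^bold>\<longrightarrow> Cong (a+1) 0 (a+1) (c+1)))"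

(* Line(p,q) and Line(r,s) are perpendicular at f; bound variables: k is 1 and l is 0. *)
definition Perp_at :: "nat \<Rightarrow> nat \<Rightarrow> nat \<Rightarrow> nat \<Rightarrow> nat \<Rightarrow> fm" where
  "Perp_at p q r s f = (Col p q f \<^bold>\<and> Col r s f \<^bold>\<and>
     Ex (Ex (1 \<^bold>\<noteq> f+2 \<^bold>\<and> Col (p+2) (q+2) 1 \<^bold>\<and>
             0 \<^bold>\<noteq> f+2 \<^bold>\<and> Col (r+2) (s+2) 0 \<^bold>\<and> Right 1 (f+2) 0)))"

definition Perp :: "nat \<Rightarrow> nat \<Rightarrow> nat \<Rightarrow> nat \<Rightarrow> fm" where
  "Perp p q r s = Ex (Perp_at (p+1) (q+1) (r+1) (s+1) 0)"

(* The matrices of the axioms; their universal closures form the theory below. *)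

definition A1 where
  "A1 a b = Cong a b b a"

definition A2 where
  "A2 a b p q r s = (Cong a b p q \<^bold>\<and> Cong a b r s \<^bold>\<longrightarrow> Cong p q r s)"

definition A3 where
  "A3 a b c = (Cong a b c c \<^bold>\<longrightarrow> a \<^bold>= b)"

definition A4i where
  "A4i q a b c = (q \<^bold>\<noteq> a \<^bold>\<longrightarrow> Ex (T (q+1) (a+1) 0 \<^bold>\<and> Cong (a+1) 0 (b+1) (c+1)))"

definition A5 where
  "A5 a b c d a' b' c' d' =
    (a \<^bold>\<noteq> b \<^bold>\<and> T a b c \<^bold>\<and> T a' b' c' \<^bold>\<and> Cong a b a' b' \<^bold>\<and> Cong b c b' c' \<^bold>\<and>
     Cong a d a' d' \<^bold>\<and> Cong b d b' d' \<^bold>\<longrightarrow> Cong c d c' d')"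

definition A6i where
  "A6i a b = (\<^bold>\<not> Btw a b a)"

definition A7i where
  "A7i a b c p q =
    (Btw a p c \<^bold>\<and> T b q c \<^bold>\<and> \<^bold>\<not> Col a b c \<^bold>\<longrightarrow>
     Ex (T (p+1) 0 (b+1) \<^bold>\<and> T (q+1) 0 (a+1)))"

definition A8 where
  "A8 = Ex (Ex (Ex (\<^bold>\<not> Col 2 1 0)))"

definition A9 where
  "A9 a b p q r =
    (a \<^bold>\<noteq> b \<^bold>\<and> Cong p a p b \<^bold>\<and> Cong q a q b \<^bold>\<and> Cong r a r b \<^bold>\<longrightarrow> Col p q r)"

definition A10 where
  "A10 a b c =
    (\<^bold>\<not> Col a b c \<^bold>\<longrightarrow> Ex (Cong (a+1) 0 (b+1) 0 \<^bold>\<and> Cong (a+1) 0 (c+1) 0))"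

definition A14i where
  "A14i a b c = (Btw a b c \<^bold>\<longrightarrow> Btw c b a)"

definition A15i where
  "A15i a b c d = (Btw a b d \<^bold>\<and> Btw b c d \<^bold>\<longrightarrow> Btw a b c)"

(* Bound variables: y is 1 and z is 0. *)
definition LC2 where
  "LC2 u v a b p =
    (Col u v p \<^bold>\<and> u \<^bold>\<noteq> v \<^bold>\<and> T a p b \<^bold>\<longrightarrow>
     Ex (Ex (Col (u+2) (v+2) 1 \<^bold>\<and> Col (u+2) (v+2) 0 \<^bold>\<and>
             Cong (a+2) 1 (a+2) (b+2) \<^bold>\<and> Cong (a+2) 0 (a+2) (b+2) \<^bold>\<and>
             T 1 (p+2) 0 \<^bold>\<and> (p+2 \<^bold>\<noteq> b+2 \<^bold>\<longrightarrow> 1 \<^bold>\<noteq> 0))))"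

definition Stab_Btw where
  "Stab_Btw a b c = (\<^bold>\<not> \<^bold>\<not> Btw a b c \<^bold>\<longrightarrow> Btw a b c)"

definition Stab_Cong where
  "Stab_Cong a b c d = (\<^bold>\<not> \<^bold>\<not> Cong a b c d \<^bold>\<longrightarrow> Cong a b c d)"

definition Stab_Eq where
  "Stab_Eq a b = (\<^bold>\<not> (a \<^bold>\<noteq> b) \<^bold>\<longrightarrow> a \<^bold>= b)"

definition Alls :: "nat \<Rightarrow> fm \<Rightarrow> fm" where
  "Alls n = All ^^ n"

definition intuitionistic_Tarski :: "fm set" where
  "intuitionistic_Tarski =
   {Alls 2 (A1 0 1),
    Alls 6 (A2 0 1 2 3 4 5),
    Alls 3 (A3 0 1 2),
    Alls 4 (A4i 0 1 2 3),
    Alls 8 (A5 0 1 2 3 4 5 6 7),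
    Alls 2 (A6i 0 1),
    Alls 5 (A7i 0 1 2 3 4),
    A8,
    Alls 5 (A9 0 1 2 3 4),
    Alls 3 (A10 0 1 2),
    Alls 3 (A14i 0 1 2),
    Alls 4 (A15i 0 1 2 3),
    Alls 5 (LC2 0 1 2 3 4),
    Alls 3 (Stab_Btw 0 1 2),
    Alls 4 (Stab_Cong 0 1 2 3),
    Alls 2 (Stab_Eq 0 1)}"

end

theory Submission
  imports Defs "HOL-Library.Countable_Set"
begin

text \<open>
  Between two existence steps the argument only needs negative formulas, and for these the stability
  axioms make classical and intuitionistic provability agree. So a negative formula is derivable as
  soon as it holds in all classical Tarski planes (a Henkin construction), and only the existence
  steps themselves have to be carried out intuitionistically, without case distinctions.

  Given a point \<open>c\<close> off \<open>Line(a,b)\<close>, produce a point of the line that is surely different from \<open>x\<close>;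
  a circle about \<open>x\<close> through a point beyond it meets the line in two distinct points \<open>p\<close>, \<open>q\<close>, and
  \<open>x\<close> lies on their perpendicular bisector whether or not it lies on the line. Lay off \<open>pq\<close> from \<open>p\<close>
  on the line \<open>cp\<close> to get \<open>c'\<close>: the centre \<open>v\<close> of the circle through \<open>p\<close>, \<open>q\<close>, \<open>c'\<close> cannot lie on
  \<open>pq\<close>, since it would be the midpoint and force \<open>c' = q\<close>. The isosceles triangle \<open>vpq\<close> yields the
  midpoint \<open>m\<close> of \<open>pq\<close> by Pasch, and \<open>Line(v,m)\<close> is the required perpendicular.

  A point off \<open>Line(a,b)\<close> is obtained uniformly by turning \<open>a\<close> about \<open>b\<close> through a right angle: a fixed
  noncollinear triple gives perpendicular lines through \<open>b\<close>, and the rotation is the product of the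
  reflections in one of them and in a bisector of the two.
\<close>

section \<open>Geometry of a classical Tarski plane\<close>

definition between :: "('a \<Rightarrow> 'a \<Rightarrow> 'a \<Rightarrow> bool) \<Rightarrow> 'a \<Rightarrow> 'a \<Rightarrow> 'a \<Rightarrow> bool" where
  "between B a b c \<longleftrightarrow> a = b \<or> b = c \<or> B a b c"

definition collinear :: "('a \<Rightarrow> 'a \<Rightarrow> 'a \<Rightarrow> bool) \<Rightarrow> 'a \<Rightarrow> 'a \<Rightarrow> 'a \<Rightarrow> bool" where
  "collinear B a b c \<longleftrightarrow> between B c a b \<or> between B a c b \<or> between B a b c"

definition midpoint ::
  "('a \<Rightarrow> 'a \<Rightarrow> 'a \<Rightarrow> bool) \<Rightarrow> ('a \<Rightarrow> 'a \<Rightarrow> 'a \<Rightarrow> 'a \<Rightarrow> bool) \<Rightarrow> 'a \<Rightarrow> 'a \<Rightarrow> 'a \<Rightarrow> bool" where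
  "midpoint B C m a b \<longleftrightarrow> between B a m b \<and> C m a m b"

text \<open>The axioms read with classical connectives, where the negative encodings
  \<open>T\<close> and \<open>Col\<close> become the plain disjunctions \<open>between\<close> and
  \<open>collinear\<close>. Line-circle continuity enters later, as a construction step.\<close>

locale tarski_plane =
  fixes B :: "'a \<Rightarrow> 'a \<Rightarrow> 'a \<Rightarrow> bool" and C :: "'a \<Rightarrow> 'a \<Rightarrow> 'a \<Rightarrow> 'a \<Rightarrow> bool"
  assumes cong_flip: "C a b b a"
    and cong_euclid: "C a b p q \<Longrightarrow> C a b r s \<Longrightarrow> C p q r s"
    and cong_identity: "C a b c c \<Longrightarrow> a = b"
    and extension: "q \<noteq> a \<Longrightarrow> \<exists>x. between B q a x \<and> C a x b c"
    and five_segment: "a \<noteq> b \<Longrightarrow> between B a b c \<Longrightarrow> between B a' b' c' \<Longrightarrow> C a b a' b' \<Longrightarrow> C b c b' c' \<Longrightarrow>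
      C a d a' d' \<Longrightarrow> C b d b' d' \<Longrightarrow> C c d c' d'"
    and B_irrefl: "\<not> B a b a"
    and strict_pasch: "B a p c \<Longrightarrow> between B b q c \<Longrightarrow> \<not> collinear B a b c \<Longrightarrow> \<exists>x. between B p x b \<and> between B q x a"
    and triangle: "\<exists>a b c. \<not> collinear B a b c"
    and upper_dim: "a \<noteq> b \<Longrightarrow> C p a p b \<Longrightarrow> C q a q b \<Longrightarrow> C r a r b \<Longrightarrow> collinear B p q r"
    and circumcentre: "\<not> collinear B a b c \<Longrightarrow> \<exists>x. C a x b x \<and> C a x c x"
    and B_sym: "B a b c \<Longrightarrow> B c b a"
    and B_inner: "B a b d \<Longrightarrow> B b c d \<Longrightarrow> B a b c"
begin

abbreviation "bet \<equiv> between B"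
abbreviation "col \<equiv> collinear B"
abbreviation "mid \<equiv> midpoint B C"

section \<open>Congruence and betweenness\<close>

lemma cong_refl: "C a b a b"
  using cong_euclid cong_flip by blast

lemma cong_sym: "C a b c d \<Longrightarrow> C c d a b"
  using cong_euclid cong_refl by blast

lemma cong_trans: "C a b c d \<Longrightarrow> C c d e f \<Longrightarrow> C a b e f"
  using cong_euclid cong_sym by blast

lemma cong_left: "C a b c d \<longleftrightarrow> C b a c d"
  using cong_flip cong_euclid by blast

lemma cong_right: "C a b c d \<longleftrightarrow> C a b d c"
  using cong_flip cong_trans by blast

lemmas cong_rules = cong_left cong_right cong_sym cong_trans cong_refl

lemma bet_sym: "bet a b c \<Longrightarrow> bet c b a"
  unfolding between_def using B_sym by blast

lemma bet_refl [simp]: "bet a a b" "bet a b b"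
  unfolding between_def by auto

lemma bet_identity: "bet a b a \<Longrightarrow> a = b"
  unfolding between_def using B_irrefl by blast

lemma bet_inner: "bet a b d \<Longrightarrow> bet b c d \<Longrightarrow> bet a b c"
  unfolding between_def using B_inner B_irrefl by blast

lemma bet_inner': "bet a b c \<Longrightarrow> bet a c d \<Longrightarrow> bet b c d"
  using bet_inner bet_sym by blast

text \<open>The degenerate positions that A7-i leaves out are harmless classically: in each of them
  one of the given points serves as \<open>x\<close>.\<close>

lemma pasch: assumes "bet a p c" "bet b q c" shows "\<exists>x. bet p x b \<and> bet q x a"
proof (cases "B a p c \<and> \<not> col a b c")
  case True then show ?thesis using strict_pasch assms by blast
next
  case False
  consider "p = a" | "p = c" | "bet c a b" | "bet a c b" | "bet a b c"
    using False assms unfolding collinear_def between_def by blast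
  then show ?thesis
  proof cases
    case 1 then show ?thesis by (meson bet_refl)
  next
    case 2 then show ?thesis using assms bet_sym by (meson bet_refl)
  next
    case 3 then show ?thesis using assms bet_inner bet_sym by (meson bet_refl)
  next
    case 4 then show ?thesis using assms bet_inner bet_sym by (meson bet_refl)
  next
    case 5 then show ?thesis using assms bet_inner bet_sym by (meson bet_refl)
  qed
qed

lemma ex_neq: "\<exists>b. b \<noteq> (a :: 'a)"
proof -
  obtain p q r where "\<not> col p q r" using triangle by blast
  then have "p \<noteq> q" unfolding collinear_def by auto
  then show ?thesis by metis
qed

lemma extension': "\<exists>x. bet q a x \<and> C a x b c"
  using extension ex_neq by (metis bet_refl(1))

lemma cong_null: "C a a b b"
  using extension' cong_identity by metis

lemma cong_null_iff: "C a b c d \<Longrightarrow> a = b \<longleftrightarrow> c = d"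
  using cong_identity cong_sym by blast

lemma sum_cong: assumes "bet a b c" "bet a' b' c'" "C a b a' b'" "C b c b' c'" shows "C a c a' c'"
proof (cases "a = b")
  case True then show ?thesis using assms cong_null_iff by blast
next
  case False
  then have "C c a c' a'" using five_segment assms cong_null cong_left cong_right by meson
  then show ?thesis using cong_left cong_right by meson
qed

text \<open>The five-segment axiom, applied to \<open>q a x\<close> and its own copy with fourth
  points \<open>x\<close> and \<open>y\<close>, gives \<open>xx = xy\<close>.\<close>

lemma extension_unique:
  assumes "q \<noteq> a" "bet q a x" "bet q a y" "C a x a y" shows "x = y"
proof -
  have "C q x q y" using assms sum_cong cong_refl by blast
  then have "C x x x y" using five_segment[OF assms(1,2,2)] assms cong_refl by blast
  then show ?thesis using cong_identity cong_sym by blast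
qed

lemma bet_outer: assumes "bet a b c" "bet b c d" "b \<noteq> c" shows "bet a c d"
proof -
  obtain x where "bet a c x" "C c x c d" using extension' by blast
  then show ?thesis using assms extension_unique bet_inner' by blast
qed

lemma bet_outer': "bet a b c \<Longrightarrow> bet b c d \<Longrightarrow> b \<noteq> c \<Longrightarrow> bet a b d"
  using bet_outer bet_sym by blast

lemma bet_trans: "bet a b c \<Longrightarrow> bet a c d \<Longrightarrow> bet a b d"
  using bet_inner' bet_outer' by (metis bet_refl(2))

text \<open>Extend \<open>ac\<close> to \<open>e\<close> and \<open>a'c'\<close> to
  \<open>e'\<close> by equal lengths. The five-segment axiom gives the distance of \<open>d\<close>
  from \<open>e\<close>; applied again from \<open>e\<close> over \<open>c\<close> back to
  \<open>b\<close>, it gives the distance from \<open>b\<close>.\<close>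

lemma inner_five_segment:
  assumes "bet a b c" "bet a' b' c'" "C a c a' c'" "C b c b' c'" "C a d a' d'" "C c d c' d'"
  shows "C b d b' d'"
proof (cases "a = c")
  case True then show ?thesis using assms bet_identity cong_null_iff by metis
next
  case False
  obtain e where e: "bet a c e" "C c e a c" using extension' by blast
  obtain e' where e': "bet a' c' e'" "C c' e' c e" using extension' by blast
  have "C e d e' d'" using five_segment[OF False e(1) e'(1)] assms e' cong_sym by blast
  moreover have "e \<noteq> c" using e False cong_null_iff by blast
  moreover have "bet e c b" "bet e' c' b'" using assms e e' bet_inner' bet_sym by blast+
  ultimately show ?thesis using five_segment[of e c b e' c' b' d d'] assms e' cong_left cong_right cong_sym
    by meson
qed

text \<open>\<open>b'\<close> and then \<open>c2\<close> are laid off from \<open>a'\<close> on the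
  side opposite to \<open>q\<close>, where \<open>c'\<close> lies too; uniqueness of extension makes
  \<open>c2\<close> equal to \<open>c'\<close>.\<close>

lemma transfer_bet:
  assumes "bet a b c" "C a c a' c'" shows "\<exists>b'. bet a' b' c' \<and> C a b a' b' \<and> C b c b' c'"
proof (cases "a = c")
  case True then show ?thesis using assms bet_identity cong_null_iff by (metis bet_refl(1))
next
  case False
  then have "a' \<noteq> c'" using assms cong_null_iff by blast
  obtain q where q: "bet c' a' q" "C a' q c' a'" using extension' by blast
  then have "q \<noteq> a'" using \<open>a' \<noteq> c'\<close> cong_null_iff by blast
  obtain b' where b': "bet q a' b'" "C a' b' a b" using extension' by blast
  obtain c2 where c2: "bet q b' c2" "C b' c2 b c" using extension' by blast
  have "bet a' b' c2" using b' c2 bet_inner' by blast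
  then have "C a' c2 a c" using sum_cong assms b' c2 by blast
  moreover have "bet q a' c2" using b' c2 bet_trans by blast
  ultimately have "c2 = c'" using extension_unique[OF \<open>q \<noteq> a'\<close>] q bet_sym assms cong_trans by blast
  then show ?thesis using \<open>bet a' b' c2\<close> b' c2 cong_sym by blast
qed

text \<open>The copy \<open>x\<close> of \<open>b\<close> on the segment \<open>a'c'\<close> has the
  same distances from its ends as \<open>b'\<close>, and the inner five-segment property turns this
  into \<open>xx = xb'\<close>.\<close>

lemma cong_bet:
  assumes "bet a b c" "C a b a' b'" "C a c a' c'" "C b c b' c'" shows "bet a' b' c'"
proof -
  obtain x where x: "bet a' x c'" "C a b a' x" "C b c x c'" using transfer_bet assms by blast
  have "C x x x b'"
    by (rule inner_five_segment[of a' x c' a' x c' x b'])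
      (use x assms cong_refl cong_left cong_right cong_sym cong_trans in meson)+
  then show ?thesis using x cong_identity cong_sym by blast
qed

section \<open>Collinearity and the connectivity of betweenness\<close>

lemma col_perm: "col a b c \<Longrightarrow> col b a c" "col a b c \<Longrightarrow> col a c b"
  unfolding collinear_def using bet_sym by blast+

lemma col_triv [simp]: "col a a b" "col a b b" "col a b a"
  unfolding collinear_def by auto

lemma bet_col: "bet a b c \<Longrightarrow> col a b c"
  unfolding collinear_def by auto

text \<open>One five-segment argument for each order of the three points. Nearly every later
  symmetry argument consists in finding two such points \<open>a\<close> and
  \<open>b\<close>.\<close>

lemma col_equidistant:
  assumes "a \<noteq> b" "col a b c" "C a p a q" "C b p b q" shows "C c p c q"
  using assms(2) unfolding collinear_def
proof (elim disjE)
  assume "bet c a b"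
  then show ?thesis using five_segment[of b a c b a c p q] assms bet_sym cong_refl by blast
next
  assume "bet a c b"
  then show ?thesis using inner_five_segment[of a c b a c b p q] assms cong_refl by blast
next
  assume "bet a b c"
  then show ?thesis using five_segment[of a b c a b c p q] assms cong_refl by blast
qed

text \<open>Gupta's proof.\<close>
lemma bet_connected:
  assumes "a \<noteq> b" and abc: "bet a b c" and abd: "bet a b d"
  shows "bet a c d \<or> bet a d c"
proof (cases "b = c")
  case True then show ?thesis using abd by blast
next
  case bc: False
  \<comment> \<open>Both routes from \<open>b\<close>, over \<open>d\<close> and \<open>c'\<close>
    and over \<open>c\<close> and \<open>d'\<close>, add up the lengths \<open>bc\<close>,
    \<open>cd\<close> and \<open>bd\<close>, so they end in one point
    \<open>b' = b''\<close>.\<close>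
  obtain c' where c': "bet a d c'" "C d c' c d" using extension' by blast
  obtain d' where d': "bet a c d'" "C c d' c d" using extension' by blast
  obtain b' where b': "bet a c' b'" "C c' b' c b" using extension' by blast
  obtain b'' where b'': "bet a d' b''" "C d' b'' d b" using extension' by blast
  note cs = cong_rules
  have bdc': "bet b d c'" using abd c' bet_inner' by blast
  have bcd': "bet b c d'" using abc d' bet_inner' by blast
  have abc': "bet a b c'" using abd c' bet_trans by blast
  have abd': "bet a b d'" using abc d' bet_trans by blast
  have bc'b': "bet b c' b'" using abc' b' bet_inner' by blast
  have bd'b'': "bet b d' b''" using abd' b'' bet_inner' by blast
  have cd'b'': "bet c d' b''" using d' b'' bet_inner' by blast
  have "C b c' b'' c"
    by (rule sum_cong[OF bdc' bet_sym[OF cd'b'']]) (use b'' c' d' cs in meson)+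
  have bcb'': "bet b c b''" using bd'b'' bcd' bet_trans by blast
  have "C b b' b'' b"
    by (rule sum_cong[OF bc'b' bet_sym[OF bcb'']]) (use \<open>C b c' b'' c\<close> b' cs in meson)+
  moreover have "bet a b b'" "bet a b b''" using abc' abd' b' b'' bet_trans by blast+
  ultimately have eq: "b'' = b'" using extension_unique[OF assms(1)] cs by meson
  have dc'b': "bet b' c' d" using c' b' bet_inner' bet_sym by blast
  have cd': "C d' c' d c"
    by (rule five_segment[OF bc bcd' dc'b'])
      (use \<open>C b c' b'' c\<close>[unfolded eq] b' c' d' cs in meson)+
  \<comment> \<open>The four segments \<open>cd\<close>, \<open>dc'\<close>, \<open>c'd'\<close>,
    \<open>d'c\<close> are congruent; \<open>e\<close> is where the diagonals \<open>cc'\<close> and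
    \<open>dd'\<close> meet, and it bisects both.\<close>
  obtain e where e: "bet c e c'" "bet d e d'"
    using pasch[of d' c b c' d] bcd' bdc' bet_sym by blast
  have ec: "C e c e c'"
    by (rule inner_five_segment[OF e(2) e(2)]) (use cd' c' d' cs in meson)+
  have ed: "C e d e d'"
    by (rule inner_five_segment[OF e(1) e(1)]) (use cd' c' d' cs in meson)+
  show ?thesis
  proof (cases "c = c' \<or> d' = e")
    case True
    then show ?thesis using c' d' ed cong_identity by blast
  next
    case False
    have "c \<noteq> d'" using False c' d' cong_null_iff by metis
    \<comment> \<open>The points \<open>c\<close> and \<open>d'\<close>, hence \<open>b\<close> and
      \<open>b'\<close>, hence \<open>c'\<close> and finally \<open>p\<close> itself turn out
      equidistant from \<open>p\<close> and \<open>q\<close>. So \<open>p = q\<close>, which forces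
      \<open>e = d'\<close>.\<close>
    obtain p where p: "bet c' c p" "C c p c d'" using extension' by blast
    obtain r where r: "bet d' c r" "C c r c e" using extension' by blast
    obtain q where q: "bet p r q" "C r q r p" using extension' by blast
    have "bet p c e" using p e bet_inner' bet_sym by blast
    have rp: "C r p e d'"
      by (rule five_segment[OF _ r(1) \<open>bet p c e\<close>]) (use \<open>c \<noteq> d'\<close> r p cs in meson)+
    have rq: "C r q e d" using q rp ed cs by meson
    have "C d c q c"
      by (rule five_segment[OF _ bet_sym[OF e(2)] q(1)]) (use False rp rq p r cs in meson)+
    then have cpq: "C c p c q" using p d' cs by meson
    have "r \<noteq> c" using r(2) ec False cong_null_iff by metis
    then have d'pq: "C d' p d' q"
      using col_equidistant[of r c d' p q] cpq q cs r bet_col col_perm by meson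
    have "C b p b q" "C b' p b' q"
      using col_equidistant[OF \<open>c \<noteq> d'\<close> _ cpq d'pq] bcd' cd'b'' bet_col col_perm eq by meson+
    then have "C c' p c' q"
      using bc'b' col_equidistant[of b b' c' p q] bet_identity bet_col col_perm by metis
    then have "C p p p q"
      using col_equidistant[of c c' p p q] False cpq p bet_col col_perm by meson
    then have "p = q" using cong_null_iff by blast
    then have "r = p" using q bet_identity by blast
    then show ?thesis using False rp cong_null_iff by blast
  qed
qed

lemma bet_connected': "a \<noteq> b \<Longrightarrow> bet a b c \<Longrightarrow> bet a b d \<Longrightarrow> bet b c d \<or> bet b d c"
  using bet_connected bet_inner' by blast

lemma bet_connected_inner: assumes "bet a b d" "bet a c d" shows "bet a b c \<or> bet a c b"
proof (cases "a = d")
  case True then show ?thesis using assms bet_identity bet_refl by metis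
next
  case False
  obtain p where p: "bet d a p" "C a p d a" using extension' by blast
  then have "p \<noteq> a" using False cong_null_iff by blast
  moreover have "bet p a b" "bet p a c" using assms p bet_inner bet_sym by blast+
  ultimately show ?thesis using bet_connected' by blast
qed

lemma col_trans: assumes "a \<noteq> b" "col a b c" "col a b d" shows "col a c d"
  using assms unfolding collinear_def
  by (smt (verit, best) bet_connected bet_connected' bet_connected_inner bet_inner bet_outer bet_outer' bet_sym bet_trans)

lemma col_trans': "a \<noteq> b \<Longrightarrow> col a b c \<Longrightarrow> col a b d \<Longrightarrow> col b c d"
  using col_trans[of b a] col_perm by blast

lemma bet_cong_eq: assumes "bet a b c" "C a b a c" shows "b = c"
proof (cases "a = c")
  case True then show ?thesis using assms bet_identity by blast
next
  case False
  obtain q where q: "bet c a q" "C a q c a" using extension' by blast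
  then have "q \<noteq> a" using False cong_null_iff by blast
  moreover have "bet q a c" "bet q a b" using q assms bet_sym bet_inner by blast+
  ultimately show ?thesis using extension_unique assms by blast
qed

text \<open>\<open>col_equidistant\<close> at the point \<open>c\<close> itself gives
  \<open>cc = cd\<close>.\<close>

lemma equidistant_eq: "a \<noteq> b \<Longrightarrow> col a b c \<Longrightarrow> C a c a d \<Longrightarrow> C b c b d \<Longrightarrow> c = d"
  using col_equidistant cong_null_iff by blast

lemma col_unique:
  "a \<noteq> b \<Longrightarrow> c \<noteq> d \<Longrightarrow> col a b c \<Longrightarrow> col a b d \<Longrightarrow> col c d e \<Longrightarrow> col a b e"
  by (metis col_perm col_trans col_trans' col_triv(1))

section \<open>Midpoints and point reflections\<close>

lemma mid_sym: "mid m a b \<Longrightarrow> mid m b a"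
  unfolding midpoint_def using bet_sym cong_sym by blast

lemma mid_triv: "mid m m b \<longleftrightarrow> m = b"
  unfolding midpoint_def using bet_refl cong_null_iff cong_refl by metis

lemma mid_neq: "mid m a b \<Longrightarrow> a \<noteq> b \<Longrightarrow> m \<noteq> a \<and> m \<noteq> b"
  using mid_triv mid_sym by metis

lemma mid_eq: "mid m a a \<longleftrightarrow> m = a"
  unfolding midpoint_def using bet_identity bet_refl cong_refl by metis

lemma ex_reflection: "\<exists>b. mid m a b"
  unfolding midpoint_def using extension' cong_rules by metis

lemma reflection_unique: "mid m a b \<Longrightarrow> mid m a c \<Longrightarrow> b = c"
  by (metis midpoint_def mid_triv extension_unique cong_euclid)

lemma col_equidistant_mid:
  assumes "col a m b" "C m a m b" shows "a = b \<or> mid m a b"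
  using assms(1) unfolding collinear_def midpoint_def
proof (elim disjE)
  assume "bet b a m" then show "a = b \<or> bet a m b \<and> C m a m b"
    using bet_cong_eq[of m a b] assms(2) bet_sym by metis
next
  assume "bet a b m" then show "a = b \<or> bet a m b \<and> C m a m b"
    using bet_cong_eq[of m b a] bet_sym cong_sym[OF assms(2)] by metis
qed (use assms(2) in simp)

lemma reflection_isometry:
  assumes "mid m p p'" "mid m q q'" shows "C p q p' q'"
proof (cases "p = m \<or> q = m")
  case True
  then show ?thesis using assms mid_triv cong_rules unfolding midpoint_def by (metis (no_types))
next
  case False
  note cs = cong_rules
  have P: "bet p m p'" "C m p m p'" and Q: "bet q m q'" "C m q m q'"
    using assms unfolding midpoint_def by auto
  \<comment> \<open>Lengthening each segment by the other's distance from \<open>m\<close> puts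
    \<open>x\<close>, \<open>y\<close>, \<open>x'\<close>, \<open>y'\<close> all at distance
    \<open>mp + mq\<close> from \<open>m\<close>.\<close>
  obtain x where x: "bet p' p x" "C p x q m" using extension' by blast
  obtain y where y: "bet q' q y" "C q y p m" using extension' by blast
  obtain x' where x': "bet p p' x'" "C p' x' q m" using extension' by blast
  obtain y' where y': "bet q q' y'" "C q' y' p m" using extension' by blast
  have ne: "p \<noteq> p'" "q \<noteq> q'" using False P Q bet_identity by blast+
  have mpx: "bet m p x" "bet m q y" "bet m p' x'" "bet m q' y'"
    using P Q x y x' y' bet_inner' bet_sym by blast+
  have xy: "C m x m y"
    using sum_cong[OF mpx(1) bet_sym[OF mpx(2)]] x y cs by meson
  have xx': "C m x m x'" using sum_cong[OF mpx(1) mpx(3)] P x x' cs by meson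
  have yy': "C m y m y'" using sum_cong[OF mpx(2) mpx(4)] Q y y' cs by meson
  have "bet p m x'" using P(1) x'(1) bet_trans by blast
  then have xmx': "bet x m x'" using mpx(1) bet_outer' bet_sym False by metis
  have "bet q m y'" using Q(1) y'(1) bet_trans by blast
  then have ymy': "bet y m y'" using mpx(2) bet_outer' bet_sym False by metis
  have "x \<noteq> m" using mpx False bet_identity by blast
  \<comment> \<open>The five-segment axiom compares \<open>x m x'\<close> with
    \<open>y' m y\<close>; the fourth points are \<open>y'\<close> and \<open>x\<close>, so that the
    one unknown distance is compared with itself reversed.\<close>
  have d: "C x' y' y x"
    by (rule five_segment[OF \<open>x \<noteq> m\<close> xmx' bet_sym[OF ymy']]) (use xy xx' yy' cs in meson)+
  have "C q x q' x'"
    by (rule inner_five_segment[OF bet_sym[OF mpx(2)] bet_sym[OF mpx(4)]])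
      (use xy xx' yy' d Q cs in meson)+
  then show ?thesis
    using inner_five_segment[OF bet_sym[OF mpx(1)] bet_sym[OF mpx(3)], of q q'] xx' P Q cs by meson
qed

lemma reflection_bet:
  assumes "mid m a a'" "mid m b b'" "mid m c c'" "bet a b c" shows "bet a' b' c'"
  using cong_bet[OF assms(4)] reflection_isometry assms by blast

lemma reflection_mid:
  assumes "mid m a a'" "mid m b b'" "mid m c c'" "mid a b c" shows "mid a' b' c'"
  unfolding midpoint_def
proof
  show "bet b' a' c'" using reflection_bet[OF assms(2,1,3)] assms(4) unfolding midpoint_def by blast
  have "C a b a c" using assms(4) unfolding midpoint_def by blast
  then show "C a' b' a' c'"
    using reflection_isometry[OF assms(1,2)] reflection_isometry[OF assms(1,3)] cong_euclid by blast
qed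

text \<open>The reflection \<open>n'\<close> of \<open>n\<close> in \<open>m\<close> has the same
  distances from \<open>a\<close> and \<open>b\<close> as \<open>n\<close>, so for
  \<open>a \<noteq> b\<close> it coincides with \<open>n\<close>; but only \<open>m\<close> is fixed
  by the reflection in \<open>m\<close>.\<close>

lemma midpoint_unique: assumes "mid m a b" "mid n a b" shows "m = n"
proof -
  obtain n' where n': "mid m n n'" using ex_reflection by blast
  have "mid n' b a" using reflection_mid[OF n' assms(1) mid_sym[OF assms(1)] assms(2)] .
  then have "C a n a n'" "C b n b n'"
    using reflection_isometry[OF n' assms(1)] reflection_isometry[OF n' mid_sym[OF assms(1)]] assms(2)
    unfolding midpoint_def using cong_rules by meson+
  moreover have "col a b n" using assms(2) bet_col col_perm unfolding midpoint_def by blast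
  ultimately have "a \<noteq> b \<Longrightarrow> n = n'" using equidistant_eq by blast
  then show ?thesis using n' mid_eq assms by metis
qed

section \<open>Isosceles triangles\<close>

lemma isosceles_not_col:
  "p \<noteq> q \<Longrightarrow> mid m p q \<Longrightarrow> C o' p o' q \<Longrightarrow> o' \<noteq> m \<Longrightarrow> \<not> col p q o'"
  using col_equidistant_mid midpoint_unique col_perm by metis

text \<open>Side conditions of the strict Pasch axiom for the triangle \<open>p'q'v\<close>, and in
  the next lemma for the triangle \<open>vqp'\<close>.\<close>

lemma isosceles_pasch_outer:
  assumes "\<not> col v p q" "bet v p p'" "p \<noteq> p'" "bet v q q'"
  shows "B p' p v" "bet q' q v" "\<not> col p' q' v"
proof -
  have ne: "v \<noteq> p" "v \<noteq> q" using assms(1) by auto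
  then show "B p' p v" "bet q' q v" using assms bet_sym unfolding between_def by metis+
  have "v \<noteq> p'" "v \<noteq> q'" using ne assms bet_identity by blast+
  then show "\<not> col p' q' v" using assms by (metis bet_col col_perm col_trans)
qed

lemma isosceles_pasch_inner:
  assumes "\<not> col v p q" "bet v p p'" "p \<noteq> p'"
  shows "B v p p'" "\<not> col v q p'"
proof -
  have ne: "v \<noteq> p" using assms(1) by auto
  then show "B v p p'" using assms unfolding between_def by metis
  have "v \<noteq> p'" using ne assms bet_identity by blast
  then show "\<not> col v q p'" using assms by (metis bet_col col_perm col_trans)
qed

text \<open>The figure is symmetric in the two legs, so the crossing point \<open>r\<close> of
  \<open>pq'\<close> and \<open>qp'\<close> is its own mirror image. Hence \<open>vr\<close> is the
  axis, and it meets the base in the midpoint.\<close>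

lemma isosceles_midpoint:
  assumes "\<not> col v p q" "C v p v q" "bet v p p'" "C p p' v p" "bet v q q'" "C q q' v p"
    and r: "bet p r q'" "bet q r p'" and m: "bet p m q" "bet r m v"
  shows "mid m p q"
proof -
  note cs = cong_rules
  have ne: "v \<noteq> p" "v \<noteq> q" "p \<noteq> q" using assms(1) by auto
  have pp': "p \<noteq> p'" "q \<noteq> q'" using ne assms cong_null_iff by metis+
  have q'p: "C q' p p' q"
    by (rule five_segment[OF ne(2) assms(5,3)]) (use assms cs in meson)+
  \<comment> \<open>\<open>s\<close> is the mirror image of \<open>r\<close>. It is shown to lie on
    both \<open>qp'\<close> and \<open>pq'\<close>, and these two lines meet only once.\<close>
  obtain s where s: "bet q s p'" "C p r q s" "C r q' s p'"
    using transfer_bet[OF r(1), of q p'] q'p cs by meson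
  have sq: "C r q s p"
    by (rule inner_five_segment[OF r(1) s(1)]) (use assms s q'p cs in meson)+
  have sp: "C r p' s q'"
    by (rule inner_five_segment[OF r(1) s(1)]) (use assms s q'p cs in meson)+
  have "C q p' p q'" using q'p cs by meson
  then have "bet p s q'" using cong_bet[OF r(2), of p s q'] sq sp cs by meson
  have nc: "\<not> col p q' q"
    using assms pp' by (metis bet_col col_perm col_trans)
  then have "r = s"
  proof -
    have "p \<noteq> q'" "q \<noteq> p'" using nc assms isosceles_pasch_inner[OF assms(1,3) pp'(1)] by auto
    show ?thesis
    proof (rule ccontr)
      assume "r \<noteq> s"
      have "col p q' r" "col p q' s" "col q p' r" "col q p' s"
        using r s \<open>bet p s q'\<close> bet_col col_perm by blast+
      then have "col r s q" using \<open>q \<noteq> p'\<close> col_trans col_perm by metis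
      then show False using nc \<open>r \<noteq> s\<close> \<open>col p q' r\<close> \<open>col p q' s\<close> \<open>p \<noteq> q'\<close> col_unique by blast
    qed
  qed
  then have "C r p r q" using s cs by meson
  moreover have "r \<noteq> v"
  proof
    assume "r = v"
    then have "col v q p'" using r bet_col col_perm by metis
    then show False using isosceles_pasch_inner[OF assms(1,3) pp'(1)] by blast
  qed
  moreover have "col r v m" using m bet_col col_perm by blast
  ultimately show ?thesis unfolding midpoint_def
    using col_equidistant[of r v m p q] assms m by blast
qed

lemma ex_isosceles_midpoint: assumes "\<not> col v p q" "C v p v q" shows "\<exists>m. mid m p q"
proof -
  obtain p' where p': "bet v p p'" "C p p' v p" using extension' by blast
  obtain q' where q': "bet v q q'" "C q q' v p" using extension' by blast
  obtain r where r: "bet p r q'" "bet q r p'" using pasch[of p' p v q' q] p' q' bet_sym by blast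
  obtain m where m: "bet p m q" "bet r m v" using pasch[of v p p' q r] p' r by blast
  show ?thesis using isosceles_midpoint[OF assms p' q' r m] by blast
qed

text \<open>If \<open>v\<close>, \<open>p\<close>, \<open>q\<close> were collinear, \<open>c\<close>
  and \<open>q\<close> would have equal distances from the two points \<open>v\<close> and
  \<open>p\<close> of a line through \<open>q\<close>, hence coincide.\<close>

lemma circumcentre_not_col:
  assumes "\<not> col p q c" "C p c p q" "C p v q v" "C p v c v" shows "\<not> col v p q"
proof
  assume col: "col v p q"
  have "v \<noteq> p" using assms cong_null_iff by (metis col_triv(3) cong_rules(1,2))
  then have "q = c" using equidistant_eq[OF _ col, of c] assms cong_rules by meson
  then show False using assms by simp
qed

section \<open>Existence of midpoints, reflection in a line, infinitude\<close>

lemma ex_not_col: assumes "a \<noteq> b" shows "\<exists>c. \<not> col a b c"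
  using triangle assms col_unique col_perm by (metis col_trans)

text \<open>For a point \<open>d\<close> off the line with \<open>ad = ab\<close>, the circumcentre
  of \<open>a\<close>, \<open>b\<close>, \<open>d\<close> is the apex of an isosceles triangle over
  \<open>ab\<close>.\<close>

lemma ex_midpoint: "\<exists>m. mid m a b"
proof (cases "a = b")
  case True then show ?thesis using mid_eq by blast
next
  case False
  obtain c where c: "\<not> col a b c" using ex_not_col[OF False] by blast
  obtain d where d: "bet c a d" "C a d a b" using extension' by blast
  have "\<not> col a b d" using c d False cong_null_iff
    by (metis bet_col col_perm col_trans)
  then obtain v where v: "C a v b v" "C a v d v" using circumcentre by blast
  then have "\<not> col v a b" using circumcentre_not_col \<open>\<not> col a b d\<close> d by blast
  then show ?thesis using ex_isosceles_midpoint v cong_rules by meson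
qed

text \<open>If \<open>f\<close> and \<open>g\<close> differ, \<open>fg\<close> is the axis of a
  mirror taking \<open>x\<close> to \<open>x'\<close> and \<open>y\<close> to \<open>y'\<close>. The
  reflections \<open>r\<close>, \<open>r'\<close> of \<open>x\<close>, \<open>x'\<close> in the
  midpoint \<open>z\<close> of \<open>fg\<close> have midpoint \<open>g\<close>, so reflection in
  \<open>g\<close> gives \<open>ry = r'y'\<close>, and the five-segment axiom leads from
  \<open>r\<close> over \<open>z\<close> back to \<open>x\<close>.\<close>

lemma mirror_isometry:
  assumes "mid f x x'" "mid g y y'" "C g x g x'" "C f y f y'" shows "C x y x' y'"
proof -
  note cs = cong_rules
  obtain z where z: "mid z f g" using ex_midpoint by blast
  have zx: "C z x z x'" "C z y z y'"
  proof -
    have "f = g \<Longrightarrow> z = f" using z mid_eq by blast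
    moreover have "col f g z" using z bet_col col_perm unfolding midpoint_def by blast
    ultimately show "C z x z x'" "C z y z y'"
      using col_equidistant[of f g z] assms unfolding midpoint_def by metis+
  qed
  obtain r where r: "mid z x r" using ex_reflection by blast
  obtain r' where r': "mid z x' r'" using ex_reflection by blast
  have "mid g r r'" using reflection_mid[OF z r r' assms(1)] .
  then have ry: "C r y r' y'" using reflection_isometry assms by blast
  show ?thesis
  proof (cases "r = z")
    case True
    then show ?thesis using r r' zx mid_triv mid_sym cong_null_iff by metis
  next
    case False
    have b: "bet r z x" "bet r' z x'" using r r' bet_sym unfolding midpoint_def by blast+
    show ?thesis
      by (rule five_segment[OF False b]) (use r r' zx ry cs in \<open>unfold midpoint_def, meson\<close>)+
  qed
qed

text \<open>Betweenness seen from \<open>a\<close> orders the other points, and none is maximal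
  because a further extension passes it. Infinitude is what lets countable models live on
  \<open>nat\<close>.\<close>

lemma infinite_points: "infinite (UNIV :: 'a set)"
proof
  assume fin: "finite (UNIV :: 'a set)"
  obtain a b :: 'a where "b \<noteq> a" using ex_neq by blast
  define R where "R x y \<longleftrightarrow> bet a x y \<and> x \<noteq> y" for x y
  have antisym: "x = y" if "bet a x y" "bet a y x" for x y
    using bet_inner'[OF that] bet_identity by blast
  have "asymp_on (- {a}) R"
    unfolding asymp_on_def R_def using antisym by blast
  moreover have "transp_on (- {a}) R"
  proof (rule transp_onI)
    fix x y z assume R: "R x y" "R y z"
    then have xyz: "bet a x y" "bet a y z" "x \<noteq> y" unfolding R_def by auto
    have "bet a x z" by (rule bet_trans[OF xyz(1,2)])
    moreover have "x \<noteq> z" using antisym xyz by blast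
    ultimately show "R x z" unfolding R_def by blast
  qed
  moreover have "finite (- {a})" "- {a} \<noteq> {}"
    using finite_subset[OF subset_UNIV fin] \<open>b \<noteq> a\<close> by auto
  ultimately obtain m where m: "m \<noteq> a" "\<And>x. x \<noteq> a \<Longrightarrow> x \<noteq> m \<Longrightarrow> \<not> R m x"
    using Finite_Set.bex_max_element[of "- {a}" R] by blast
  obtain x where "bet a m x" "C m x a m" using extension' by blast
  then have "R m x" "x \<noteq> a" "x \<noteq> m"
    unfolding R_def using m(1) cong_null_iff bet_identity by metis+
  then show False using m by blast
qed

section \<open>Geometry of the single construction steps\<close>

lemma longer_extension: assumes "a \<noteq> b" "bet a b y" "C b y b x" "bet a y z" "C y z a b" shows "x \<noteq> z"
proof
  \<comment> \<open>\<open>y\<close> is as far from \<open>b\<close> as \<open>x\<close>, and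
    \<open>z\<close> lies beyond \<open>y\<close> by the positive length \<open>ab\<close>. This
    yields a point of \<open>Line(a,b)\<close> different from \<open>x\<close> without asking where
    \<open>x\<close> is.\<close>
  assume "x = z"
  have "bet b y z" using assms bet_inner' by blast
  then have "y = z" using bet_cong_eq \<open>x = z\<close> assms by blast
  then show False using assms cong_null_iff by blast
qed

lemma bisector_col: "p \<noteq> q \<Longrightarrow> C x p x q \<Longrightarrow> C v p v q \<Longrightarrow> mid m p q \<Longrightarrow> col v m x"
  using upper_dim unfolding midpoint_def using cong_rules by meson

text \<open>\<open>x'\<close> is the mirror image of \<open>x\<close> in \<open>Line(p,q)\<close>:
  reflection in \<open>m\<close> turns \<open>px\<close> into \<open>qx'\<close>, so
  \<open>q\<close> is equidistant from \<open>x\<close> and \<open>x'\<close>, as is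
  \<open>m\<close>; the other points of the line follow.\<close>

lemma mirror_axis:
  assumes "p \<noteq> q" "C x p x q" "mid m p q" "mid m x x'" "col p q a" shows "C a x a x'"
proof -
  have "C q x q x'" using reflection_isometry[OF assms(3,4)] assms(2) cong_rules by meson
  moreover have "C m x m x'" using assms(4) unfolding midpoint_def by blast
  moreover have "m \<noteq> q" using mid_neq assms by blast
  moreover have "col p q m" using assms(3) bet_col col_perm unfolding midpoint_def by blast
  then have "col q m a" using assms(1,5) col_trans' by blast
  ultimately show ?thesis using col_equidistant[of q m a x x'] by blast
qed

text \<open>A4-i extends only over distinct points, and \<open>x = m\<close> is possible. The detour
  uses points that are surely apart: \<open>w\<close> lies beyond \<open>s\<close> by the length
  \<open>vm\<close>, \<open>w'\<close> is its reflection in \<open>m\<close>, \<open>w''\<close>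
  lies beyond \<open>w'\<close>, and going back from \<open>w'\<close> by the length
  \<open>wx\<close> reaches the reflection of \<open>x\<close>.\<close>

lemma point_reflection:
  assumes "v \<noteq> m" "col v m x" and s: "bet v m s" "C m s m x" and w: "bet v s w" "C s w v m"
    and w': "bet w m w'" "C m w' m w" and w2: "bet w w' w''" "C w' w'' v m"
    and x': "bet w'' w' x'" "C w' x' w x"
  shows "v \<noteq> s" "w \<noteq> m" "w \<noteq> w'" "w'' \<noteq> w'" "mid m x x'"
proof -
  show "v \<noteq> s" using assms bet_identity by blast
  have msw: "bet m s w" using s w bet_inner' by blast
  have "s \<noteq> w" using w assms cong_null_iff by blast
  then show "w \<noteq> m" using msw bet_identity by blast
  then show "w \<noteq> w'" using w' bet_identity by blast
  show "w'' \<noteq> w'" using w2 assms cong_null_iff by blast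
  have ww': "mid m w w'" unfolding midpoint_def using w' cong_rules by meson
  have "bet w x w'"
  proof -
    \<comment> \<open>\<open>s\<close> is \<open>x\<close> or the reflection of \<open>x\<close> in
      \<open>m\<close>; either way \<open>x\<close> lies between \<open>w\<close> and
      \<open>w'\<close>.\<close>
    have "col m s x" using s assms bet_col col_trans' by blast
    then have "col s m x" using col_perm by blast
    then consider "s = x" | "mid m s x" using col_equidistant_mid s by blast
    then show ?thesis
    proof cases
      case 1
      then show ?thesis using msw w' bet_inner bet_sym bet_trans by meson
    next
      case 2
      then have "bet m x w'" using reflection_bet[of m m m s x w w'] ww' msw mid_triv by blast
      then show ?thesis using w' bet_sym bet_trans bet_inner by meson
    qed
  qed
  obtain y where y: "mid m x y" using ex_reflection by blast
  have "bet w' y w" using reflection_bet[OF ww' y mid_sym[OF ww'] \<open>bet w x w'\<close>] .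
  then have "bet w'' w' y" using w2 bet_inner bet_sym by meson
  moreover have "C w' y w' x'"
    using reflection_isometry[OF ww' y] x' cong_rules by meson
  ultimately have "y = x'" using extension_unique[OF \<open>w'' \<noteq> w'\<close>] x' by blast
  then show "mid m x x'" using y by blast
qed

section \<open>The quarter turn that takes a point off its line\<close>

lemma square_frame:
  assumes "p \<noteq> q" "mid m p q" "C v p v q" "v \<noteq> m" "bet v m n" "C m n m p"
  shows "\<not> col p q n" "C m p m n" "C n p n q" "\<not> col m p n"
proof -
  show mn: "C m p m n" using assms cong_rules by meson
  have mpq: "C m p m q" using assms cong_rules unfolding midpoint_def by meson
  have "m \<noteq> p" using assms mid_neq by blast
  then have "m \<noteq> n" using assms(6) cong_null_iff by metis
  have "col v m n" using assms bet_col by blast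
  then show npq: "C n p n q" using col_equidistant[OF assms(4)] assms mpq by blast
  show "\<not> col p q n" using isosceles_not_col[of p q m n] assms \<open>m \<noteq> n\<close> npq by blast
  then show "\<not> col m p n"
    using assms(2) \<open>m \<noteq> p\<close> bet_col col_perm col_trans unfolding midpoint_def by metis
qed

text \<open>Serves to supply a point off the second mirror \<open>bd\<close>, the bisector of the
  right angle at \<open>b\<close>.\<close>

lemma midpoint_off_side: assumes "\<not> col b e n" "mid d e n" shows "\<not> col b d e"
proof
  assume "col b d e"
  have "e \<noteq> n" using assms by auto
  then have "d \<noteq> e" using assms mid_neq by blast
  have "col e d n" using assms bet_col unfolding midpoint_def by blast
  then show False using assms \<open>col b d e\<close> \<open>d \<noteq> e\<close> col_trans' col_perm by meson
qed

text \<open>\<open>c\<close> is the image of \<open>a\<close> under the quarter turn about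
  \<open>b\<close> taking \<open>e\<close> to \<open>n\<close> and \<open>n\<close> to
  \<open>w\<close>. On \<open>Line(a,b)\<close> it could only be \<open>a\<close> or the reflection
  of \<open>a\<close> in \<open>b\<close>. Either way \<open>a\<close> is equidistant from
  \<open>e\<close> and \<open>w\<close>, or from \<open>n\<close> and \<open>s\<close>, and so lies
  on one of the two axes; together with \<open>ae = an\<close> and \<open>be = bn\<close> this
  forces \<open>e = n\<close>.\<close>

lemma quarter_turn_not_col:
  assumes "a \<noteq> b" "mid b e w" "mid b n s" "C n e n w" "\<not> col b e n" and ben: "C b e b n"
    and c: "C b a b c" "C a e c n" "C a n c w"
  shows "\<not> col a b c"
proof
  note cs = cong_rules
  assume "col a b c"
  have ne: "e \<noteq> w" "n \<noteq> s" "e \<noteq> n" "b \<noteq> n" "b \<noteq> e" using assms mid_eq by auto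
  consider "c = a" | "mid b a c" using col_equidistant_mid c \<open>col a b c\<close> by blast
  then show False
  proof cases
    case 1
    have a: "C a e a n" "C a w a e" using 1 c cs by meson+
    have "col a b n"
      by (rule upper_dim[OF ne(1)]) (use a assms cs in \<open>unfold midpoint_def, meson\<close>)+
    then show False using equidistant_eq[OF assms(1), of n e] cong_sym a ben ne by metis
  next
    case 2
    have "C a s c n" "C a w c e" "C a e c w"
      using reflection_isometry[OF 2 mid_sym[OF assms(3)]] reflection_isometry[OF 2 mid_sym[OF assms(2)]]
       reflection_isometry[OF 2 assms(2)] by blast+
    then have a: "C a e a n" "C a s a n" using c cs by meson+
    have "C e s w n" using reflection_isometry[OF assms(2) mid_sym[OF assms(3)]] .
    then have "C e n e s" using assms cs by meson
    then have "col a b e"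
      by (intro upper_dim[OF ne(2)]) (use a assms cs in \<open>unfold midpoint_def, meson\<close>)+
    then show False using equidistant_eq[OF assms(1), of e n] a ben ne by metis
  qed
qed

text \<open>The mirror in \<open>ew\<close> fixes \<open>e\<close> and takes \<open>n\<close> to its
  reflection \<open>s\<close> in \<open>b\<close>; the mirror in \<open>bd\<close> takes
  \<open>e\<close> to \<open>n\<close> and \<open>s\<close> to \<open>w\<close>. Their product is
  the quarter turn, so the distances of \<open>c\<close> from \<open>n\<close> and \<open>w\<close>
  are those of \<open>a\<close> from \<open>e\<close> and \<open>n\<close>.\<close>

lemma double_mirror_not_col:
  assumes "a \<noteq> b" "mid b e w" "C n e n w" "\<not> col b e n" "C b e b n" "mid d e n"
    and a': "mid f a a'" "col e w f" "C e a e a'" "C w a w a'"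
    and c: "mid g a' c" "col b d g" "C b a' b c" "C d a' d c"
  shows "\<not> col a b c"
proof -
  note cs = cong_rules
  obtain s where s: "mid b n s" using ex_reflection by blast
  obtain d' where d': "mid b d d'" using ex_reflection by blast
  have "b \<noteq> e" "e \<noteq> n" using assms(4) by auto
  then have "e \<noteq> w" using assms(2) mid_eq by metis
  have col_ewb: "col e w b" using assms(2) bet_col col_perm unfolding midpoint_def by blast
  have bns: "C b n b s" "C b e b w" using s assms(2) unfolding midpoint_def by auto
  have ens: "C e s w n" "C e n w s"
    using reflection_isometry[OF assms(2) mid_sym[OF s]] reflection_isometry[OF assms(2) s] .
  have "C f n f s"
    using col_equidistant[OF \<open>e \<noteq> w\<close> a'(2), of n s] ens assms(3) cs by meson
  have "C b a b a'" using col_equidistant[OF \<open>e \<noteq> w\<close> col_ewb] a' by blast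
  have an: "C a n a' s" by (rule mirror_isometry[OF a'(1) s \<open>C b a b a'\<close> \<open>C f n f s\<close>])
  have "b \<noteq> d" using assms(4,6) bet_col col_perm unfolding midpoint_def by blast
  have bdd': "col b d d'" using d' bet_col col_perm unfolding midpoint_def by blast
  have "b \<noteq> d'" using \<open>b \<noteq> d\<close> d' mid_triv mid_sym by metis
  have "C d e d n" using assms(6) unfolding midpoint_def by blast
  then have "C g e g n" using col_equidistant[OF \<open>b \<noteq> d\<close> c(2)] assms(5) by blast
  have ce: "C a' e c n" by (rule mirror_isometry[OF c(1) assms(6) c(4) \<open>C g e g n\<close>])
  have d'ws: "mid d' w s" by (rule reflection_mid[OF d' assms(2) s assms(6)])
  then have "C d' w d' s" unfolding midpoint_def by blast
  moreover have "C b w b s" using bns assms(5) cs by meson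
  moreover have "col b d' g" using \<open>b \<noteq> d\<close> bdd' c(2) col_trans by blast
  ultimately have "C g s g w" using col_equidistant[OF \<open>b \<noteq> d'\<close>] cs by meson
  have "C d' a' d' c" using col_equidistant[OF \<open>b \<noteq> d\<close> bdd'] c by blast
  have cs': "C a' s c w"
    by (rule mirror_isometry[OF c(1) mid_sym[OF d'ws] \<open>C d' a' d' c\<close> \<open>C g s g w\<close>])
  show ?thesis
  proof (rule quarter_turn_not_col[OF assms(1,2) s assms(3,4,5)])
    show "C b a b c" using \<open>C b a b a'\<close> c(3) cong_trans by blast
    show "C a e c n" using a'(3) ce cs by meson
    show "C a n c w" using an cs' cong_trans by blast
  qed
qed

end

section \<open>Substitution and derivations\<close>

lemma under_simps [simp]: "under f 0 = 0" "under f (Suc n) = Suc (f n)"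
  by (simp_all add: under_def)

lemma under_comp: "under f \<circ> under g = under (f \<circ> g)"
  by (auto simp: under_def fun_eq_iff split: nat.split)

lemma under_id: "under (\<lambda>n. n) = (\<lambda>n. n)"
  by (auto simp: under_def fun_eq_iff split: nat.split)

lemma ren_ren: "ren f (ren g \<phi>) = ren (f \<circ> g) \<phi>"
  by (induction \<phi> arbitrary: f g) (auto simp: under_comp)

lemma ren_id: "ren (\<lambda>n. n) \<phi> = \<phi>"
  by (induction \<phi>) (auto simp: under_id)

lemma inst_ren: "inst (ren (under f) \<phi>) t = ren (case_nat t f) \<phi>"
  unfolding inst_def ren_ren by (rule arg_cong[of _ _ "\<lambda>f. ren f \<phi>"]) (auto split: nat.split simp: under_def)

lemma ren_inst: "ren f (inst \<phi> t) = inst (ren (under f) \<phi>) (f t)"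
  unfolding inst_ren unfolding inst_def ren_ren
  by (rule arg_cong[of _ _ "\<lambda>f. ren f \<phi>"]) (auto split: nat.split)

lemma ren_Suc_under: "ren (under f) (ren Suc \<phi>) = ren Suc (ren f \<phi>)"
  unfolding ren_ren by (rule arg_cong[of _ _ "\<lambda>f. ren f \<phi>"]) auto

lemma inst_shift: "inst (ren (under Suc) \<phi>) 0 = \<phi>"
proof -
  have "case_nat 0 Suc = (\<lambda>n. n)" by (auto split: nat.split)
  then show ?thesis by (simp add: inst_ren ren_id)
qed

section \<open>Free variables\<close>

primrec fv :: "fm \<Rightarrow> nat set" where
  "fv \<^bold>\<bottom> = {}"
| "fv (a \<^bold>= b) = {a, b}"
| "fv (Btw a b c) = {a, b, c}"
| "fv (Cong a b c d) = {a, b, c, d}"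
| "fv (\<phi> \<^bold>\<and> \<psi>) = fv \<phi> \<union> fv \<psi>"
| "fv (\<phi> \<^bold>\<or> \<psi>) = fv \<phi> \<union> fv \<psi>"
| "fv (\<phi> \<^bold>\<longrightarrow> \<psi>) = fv \<phi> \<union> fv \<psi>"
| "fv (All \<phi>) = {n. Suc n \<in> fv \<phi>}"
| "fv (Ex \<phi>) = {n. Suc n \<in> fv \<phi>}"

lemma finite_fv: "finite (fv \<phi>)"
  by (induction \<phi>) (auto intro: finite_vimageI[of _ Suc, unfolded vimage_def])

lemma ren_cong: "\<forall>n\<in>fv \<phi>. f n = g n \<Longrightarrow> ren f \<phi> = ren g \<phi>"
proof (induction \<phi> arbitrary: f g)
  case (All \<phi>)
  have "ren (under f) \<phi> = ren (under g) \<phi>"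
    by (rule All.IH) (auto simp: under_def All.prems split: nat.split)
  then show ?case by simp
next
  case (Ex \<phi>)
  have "ren (under f) \<phi> = ren (under g) \<phi>"
    by (rule Ex.IH) (auto simp: under_def Ex.prems split: nat.split)
  then show ?case by simp
qed (simp_all add: ball_Un)

lemma under_image: "{n. Suc n \<in> under f ` A} = f ` {n. Suc n \<in> A}"
proof (intro equalityI subsetI)
  fix n assume "n \<in> {n. Suc n \<in> under f ` A}"
  then obtain m where "m \<in> A" "Suc n = under f m" by blast
  then show "n \<in> f ` {n. Suc n \<in> A}" by (cases m) auto
qed (auto simp: image_iff intro!: bexI[of _ "Suc _"])

lemma fv_ren: "fv (ren f \<phi>) = f ` fv \<phi>"
  by (induction \<phi> arbitrary: f) (auto simp: under_image)

lemma fv_inst: "fv (inst \<phi> t) \<subseteq> insert t (fv (Ex \<phi>))"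
  unfolding inst_def fv_ren by (auto split: nat.splits)

section \<open>Weakening, renaming and finiteness of derivations\<close>

lemma weaken: "\<Gamma> \<turnstile> \<phi> \<Longrightarrow> \<Gamma> \<subseteq> \<Delta> \<Longrightarrow> \<Delta> \<turnstile> \<phi>"
proof (induction arbitrary: \<Delta> rule: derives.induct)
  case (OrE \<Gamma> \<phi> \<psi> \<chi>)
  then show ?case by (meson derives.OrE insert_mono)
next
  case (ImpI \<phi> \<Gamma> \<psi>)
  then show ?case by (meson derives.ImpI insert_mono)
next
  case (ExE \<Gamma> \<phi> \<chi>)
  show ?case by (rule derives.ExE[OF ExE.IH(1)[OF ExE.prems] ExE.IH(2)]) (use ExE.prems in blast)
next
  case (AllI \<Gamma> \<phi>)
  then show ?case by (meson derives.AllI image_mono)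
next
  case (EqE \<Gamma> a b \<phi>)
  then show ?case by (meson derives.EqE)
qed (auto intro: derives.intros)

lemma derives_ren: "\<Gamma> \<turnstile> \<phi> \<Longrightarrow> ren f ` \<Gamma> \<turnstile> ren f \<phi>"
proof (induction arbitrary: f rule: derives.induct)
  case (AllI \<Gamma> \<phi>)
  have "ren (under f) ` ren Suc ` \<Gamma> = ren Suc ` ren f ` \<Gamma>"
    by (simp add: image_image ren_Suc_under)
  then show ?case using AllI.IH[of "under f"] by (auto intro: derives.AllI)
next
  case (ExE \<Gamma> \<phi> \<chi>)
  have "ren (under f) ` ren Suc ` \<Gamma> = ren Suc ` ren f ` \<Gamma>"
    by (simp add: image_image ren_Suc_under)
  then show ?case using ExE.IH(1)[of f] ExE.IH(2)[of "under f"]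
    by (auto intro: derives.ExE simp: ren_Suc_under)
next
  case (AllE \<Gamma> \<phi> t)
  then show ?case using derives.AllE[of "ren f ` \<Gamma>" "ren (under f) \<phi>" "f t"] by (simp add: ren_inst)
next
  case (ExI \<Gamma> \<phi> t)
  then show ?case by (auto simp: ren_inst intro: derives.ExI)
next
  case (EqE \<Gamma> a b \<phi>)
  then show ?case using derives.EqE[of "ren f ` \<Gamma>" "f a" "f b" "ren (under f) \<phi>"] by (simp add: ren_inst)
qed (auto intro: derives.intros)

lemma derives_finite: "\<Gamma> \<turnstile> \<phi> \<Longrightarrow> \<exists>F\<subseteq>\<Gamma>. finite F \<and> (F \<turnstile> \<phi>)"
proof (induction rule: derives.induct)
  case (Assm \<phi> \<Gamma>)
  then show ?case by (intro exI[of _ "{\<phi>}"]) (auto intro: derives.Assm)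
next
  case (BotE \<Gamma> \<phi>)
  then show ?case by (meson derives.BotE)
next
  case (AndI \<Gamma> \<phi> \<psi>)
  then obtain F G where "F \<subseteq> \<Gamma>" "finite F" "F \<turnstile> \<phi>" "G \<subseteq> \<Gamma>" "finite G" "G \<turnstile> \<psi>" by blast
  then show ?case
    by (intro exI[of _ "F \<union> G"]) (auto intro!: derives.AndI elim: weaken)
next
  case (AndE1 \<Gamma> \<phi> \<psi>)
  then show ?case by (meson derives.AndE1)
next
  case (AndE2 \<Gamma> \<phi> \<psi>)
  then show ?case by (meson derives.AndE2)
next
  case (OrI1 \<Gamma> \<phi> \<psi>)
  then show ?case by (meson derives.OrI1)
next
  case (OrI2 \<Gamma> \<psi> \<phi>)
  then show ?case by (meson derives.OrI2)
next
  case (OrE \<Gamma> \<phi> \<psi> \<chi>)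
  then obtain F G H where F: "F \<subseteq> \<Gamma>" "finite F" "F \<turnstile> \<phi> \<^bold>\<or> \<psi>"
    and G: "G \<subseteq> insert \<phi> \<Gamma>" "finite G" "G \<turnstile> \<chi>" and H: "H \<subseteq> insert \<psi> \<Gamma>" "finite H" "H \<turnstile> \<chi>"
    by meson
  let ?F = "F \<union> (G - {\<phi>}) \<union> (H - {\<psi>})"
  have "?F \<turnstile> \<chi>"
    by (rule derives.OrE[of _ \<phi> \<psi>]; rule weaken[OF F(3)] weaken[OF G(3)] weaken[OF H(3)]) auto
  then show ?case using F G H by (intro exI[of _ ?F]) auto
next
  case (ImpI \<phi> \<Gamma> \<psi>)
  then obtain G where G: "G \<subseteq> insert \<phi> \<Gamma>" "finite G" "G \<turnstile> \<psi>" by meson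
  have "G - {\<phi>} \<turnstile> \<phi> \<^bold>\<longrightarrow> \<psi>" by (rule derives.ImpI, rule weaken[OF G(3)]) auto
  then show ?case using G by (intro exI[of _ "G - {\<phi>}"]) auto
next
  case (ImpE \<Gamma> \<phi> \<psi>)
  then obtain F G where "F \<subseteq> \<Gamma>" "finite F" "F \<turnstile> \<phi> \<^bold>\<longrightarrow> \<psi>" "G \<subseteq> \<Gamma>" "finite G" "G \<turnstile> \<phi>" by blast
  then show ?case
    by (intro exI[of _ "F \<union> G"]) (auto intro!: derives.ImpE[of _ \<phi> \<psi>] elim: weaken)
next
  case (AllI \<Gamma> \<phi>)
  then obtain F where "F \<subseteq> ren Suc ` \<Gamma>" "finite F" "F \<turnstile> \<phi>" by blast
  then obtain G where "G \<subseteq> \<Gamma>" "finite G" "F = ren Suc ` G" by (meson finite_subset_image)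
  then show ?case using \<open>F \<turnstile> \<phi>\<close> derives.AllI by blast
next
  case (AllE \<Gamma> \<phi> t)
  then show ?case by (meson derives.AllE)
next
  case (ExI \<Gamma> \<phi> t)
  then show ?case by (meson derives.ExI)
next
  case (ExE \<Gamma> \<phi> \<chi>)
  then obtain F G where F: "F \<subseteq> \<Gamma>" "finite F" "F \<turnstile> Ex \<phi>"
    and G: "G \<subseteq> insert \<phi> (ren Suc ` \<Gamma>)" "finite G" "G \<turnstile> ren Suc \<chi>" by meson
  have "G - {\<phi>} \<subseteq> ren Suc ` \<Gamma>" "finite (G - {\<phi>})" using G by auto
  then obtain H where H: "H \<subseteq> \<Gamma>" "finite H" "G - {\<phi>} = ren Suc ` H"
    by (meson finite_subset_image)
  have "F \<union> H \<turnstile> \<chi>"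
    by (rule derives.ExE; rule weaken[OF F(3)] weaken[OF G(3)]) (use H in auto)
  then show ?case using F H by (intro exI[of _ "F \<union> H"]) auto
next
  case (EqI \<Gamma> a)
  then show ?case by (intro exI[of _ "{}"]) (auto intro: derives.EqI)
next
  case (EqE \<Gamma> a b \<phi>)
  then obtain F G where "F \<subseteq> \<Gamma>" "finite F" "F \<turnstile> a \<^bold>= b" "G \<subseteq> \<Gamma>" "finite G" "G \<turnstile> inst \<phi> a" by blast
  then show ?case
    by (intro exI[of _ "F \<union> G"]) (auto intro!: derives.EqE[of _ a b] elim: weaken)
qed

lemma cut: "\<Gamma> \<turnstile> \<phi> \<Longrightarrow> insert \<phi> \<Gamma> \<turnstile> \<psi> \<Longrightarrow> \<Gamma> \<turnstile> \<psi>"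
  using ImpI ImpE by blast

text \<open>The renaming \<open>f\<close> moves \<open>k\<close> to \<open>0\<close> and all other
  indices up by one. On formulas without \<open>k\<close> it acts as \<open>Suc\<close>, and it
  turns the instance at \<open>k\<close> back into the body, which is the form \<open>ExE\<close>
  demands.\<close>

lemma ExE_fresh:
  assumes "\<Gamma> \<turnstile> Ex \<phi>" "insert (inst \<phi> k) \<Gamma> \<turnstile> \<chi>" "k \<notin> fv (Ex \<phi>)" "k \<notin> fv \<chi>" "\<And>\<psi>. \<psi> \<in> \<Gamma> \<Longrightarrow> k \<notin> fv \<psi>"
  shows "\<Gamma> \<turnstile> \<chi>"
proof -
  define f where "f = (\<lambda>n. if n = k then 0 else Suc n)"
  have shift: "ren f \<psi> = ren Suc \<psi>" if "k \<notin> fv \<psi>" for \<psi>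
    by (rule ren_cong) (use that in \<open>auto simp: f_def\<close>)
  have "ren f (inst \<phi> k) = ren (\<lambda>n. n) \<phi>"
    unfolding inst_def ren_ren
    by (rule ren_cong) (use assms(3) in \<open>auto simp: f_def split: nat.split\<close>)
  then have "ren f (inst \<phi> k) = \<phi>" by (simp add: ren_id)
  moreover have "ren f ` \<Gamma> = ren Suc ` \<Gamma>" using shift assms(5) by (auto simp: image_iff)
  ultimately have "insert \<phi> (ren Suc ` \<Gamma>) \<turnstile> ren Suc \<chi>"
    using derives_ren[OF assms(2), of f] shift[OF assms(4)] by simp
  then show ?thesis using ExE assms(1) by blast
qed

section \<open>Henkin sets\<close>

instance fm :: countable by countable_datatype

text \<open>Every formula is decided by membership, so these sets behave classically although
  derivability is intuitionistic.\<close>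

definition henkin :: "fm set \<Rightarrow> bool" where
  "henkin \<Delta> \<longleftrightarrow> \<not> (\<Delta> \<turnstile> \<^bold>\<bottom>) \<and> (\<forall>\<phi>. \<phi> \<in> \<Delta> \<or> (\<^bold>\<not> \<phi>) \<in> \<Delta>) \<and> (\<forall>\<phi>. Ex \<phi> \<in> \<Delta> \<longrightarrow> (\<exists>t. inst \<phi> t \<in> \<Delta>))"

definition fresh :: "fm set \<Rightarrow> nat" where
  "fresh S = (SOME k. k \<notin> \<Union> (fv ` S))"

text \<open>An existential formula receives its witness as soon as it is added. A fresh variable is
  available while the set has only finitely many free variables, as is the case for the closed
  axioms and one more formula.\<close>

definition henkin_step :: "fm set \<Rightarrow> fm \<Rightarrow> fm set" where
  "henkin_step S \<phi> = (if (insert \<phi> S \<turnstile> \<^bold>\<bottom>) then insert (\<^bold>\<not> \<phi>) S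
     else case \<phi> of Ex \<psi> \<Rightarrow> insert (inst \<psi> (fresh (insert \<phi> S))) (insert \<phi> S) | _ \<Rightarrow> insert \<phi> S)"

primrec henkin_chain :: "fm set \<Rightarrow> nat \<Rightarrow> fm set" where
  "henkin_chain S 0 = S"
| "henkin_chain S (Suc n) = henkin_step (henkin_chain S n) (from_nat n)"

lemma fv_Neg [simp]: "fv (\<^bold>\<not> \<phi>) = fv \<phi>"
  by (simp add: Neg_def)

lemma subset_henkin_step: "S \<subseteq> henkin_step S \<phi>"
  unfolding henkin_step_def by (auto split: fm.split)

lemma henkin_step_decides: "\<phi> \<in> henkin_step S \<phi> \<or> (\<^bold>\<not> \<phi>) \<in> henkin_step S \<phi>"
  unfolding henkin_step_def by (auto split: fm.split)

lemma finite_fv_henkin_step: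
  assumes "finite (\<Union> (fv ` S))" shows "finite (\<Union> (fv ` henkin_step S \<phi>))"
proof -
  have "\<exists>F. finite F \<and> henkin_step S \<phi> = F \<union> S"
  proof (cases "insert \<phi> S \<turnstile> \<^bold>\<bottom>")
    case True
    then show ?thesis unfolding henkin_step_def by (intro exI[of _ "{\<^bold>\<not> \<phi>}"]) simp
  next
    case False
    show ?thesis
    proof (cases "\<exists>\<psi>. \<phi> = Ex \<psi>")
      case True
      then obtain \<psi> where "\<phi> = Ex \<psi>" by blast
      then show ?thesis using False unfolding henkin_step_def
        by (intro exI[of _ "{inst \<psi> (fresh (insert \<phi> S)), \<phi>}"]) simp
    next
      case nex: False
      then show ?thesis using False unfolding henkin_step_def
        by (intro exI[of _ "{\<phi>}"]) (auto split: fm.split)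
    qed
  qed
  then show ?thesis using assms finite_fv by auto
qed

lemma henkin_step_consistent:
  assumes "\<not> (S \<turnstile> \<^bold>\<bottom>)" "finite (\<Union> (fv ` S))" shows "\<not> (henkin_step S \<phi> \<turnstile> \<^bold>\<bottom>)"
proof (cases "insert \<phi> S \<turnstile> \<^bold>\<bottom>")
  case True
  then have "S \<turnstile> \<^bold>\<not> \<phi>" unfolding Neg_def by (rule ImpI)
  then show ?thesis using True cut assms(1) unfolding henkin_step_def by auto
next
  case False
  show ?thesis
  proof (cases "\<exists>\<psi>. \<phi> = Ex \<psi>")
    case True
    then obtain \<psi> where \<psi>: "\<phi> = Ex \<psi>" by blast
    let ?k = "fresh (insert \<phi> S)"
    have "finite (\<Union> (fv ` insert \<phi> S))" using assms(2) finite_fv by auto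
    then have "\<exists>k. k \<notin> \<Union> (fv ` insert \<phi> S)" using ex_new_if_finite infinite_UNIV_nat by blast
    then have k: "?k \<notin> \<Union> (fv ` insert \<phi> S)" unfolding fresh_def by (rule someI_ex)
    show ?thesis
    proof
      assume "henkin_step S \<phi> \<turnstile> \<^bold>\<bottom>"
      then have *: "insert (inst \<psi> ?k) (insert \<phi> S) \<turnstile> \<^bold>\<bottom>"
        using False \<psi> unfolding henkin_step_def by simp
      have "insert \<phi> S \<turnstile> Ex \<psi>" using Assm \<psi> by blast
      then have "insert \<phi> S \<turnstile> \<^bold>\<bottom>"
        by (rule ExE_fresh[OF _ *]) (use k \<psi> in auto)
      then show False using False by blast
    qed
  next
    case nex: False
    then have "henkin_step S \<phi> = insert \<phi> S"
      using False unfolding henkin_step_def by (auto split: fm.split)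
    then show ?thesis using False by simp
  qed
qed

lemma henkin_step_witness:
  assumes "Ex \<psi> \<in> henkin_step S (Ex \<psi>)" "\<not> (henkin_step S (Ex \<psi>) \<turnstile> \<^bold>\<bottom>)"
  shows "\<exists>t. inst \<psi> t \<in> henkin_step S (Ex \<psi>)"
proof (cases "insert (Ex \<psi>) S \<turnstile> \<^bold>\<bottom>")
  case True
  then have "insert (Ex \<psi>) (henkin_step S (Ex \<psi>)) \<turnstile> \<^bold>\<bottom>"
    by (rule weaken) (use subset_henkin_step in blast)
  then show ?thesis using assms by (simp add: insert_absorb)
next
  case False
  then show ?thesis unfolding henkin_step_def by auto
qed

lemma ex_henkin:
  assumes "\<not> (S \<turnstile> \<^bold>\<bottom>)" "finite (\<Union> (fv ` S))" shows "\<exists>\<Delta>. S \<subseteq> \<Delta> \<and> henkin \<Delta>"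
proof -
  define \<Delta> where "\<Delta> = (\<Union>n. henkin_chain S n)"
  have inv: "\<not> (henkin_chain S n \<turnstile> \<^bold>\<bottom>) \<and> finite (\<Union> (fv ` henkin_chain S n))" for n
    by (induction n) (use assms henkin_step_consistent finite_fv_henkin_step in auto)
  have mono: "henkin_chain S m \<subseteq> henkin_chain S n" if "m \<le> n" for m n
    using that by (induction rule: dec_induct) (use subset_henkin_step in auto)
  have "\<exists>n. F \<subseteq> henkin_chain S n" if "finite F" "F \<subseteq> \<Delta>" for F
    using that
  proof (induction F rule: finite_induct)
    case (insert \<phi> F)
    then obtain m n where "F \<subseteq> henkin_chain S m" "\<phi> \<in> henkin_chain S n" unfolding \<Delta>_def by blast
    then have "insert \<phi> F \<subseteq> henkin_chain S (max m n)"
      using mono[of m "max m n"] mono[of n "max m n"] by auto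
    then show ?case by blast
  qed simp
  \<comment> \<open>A derivation of absurdity uses finitely many formulas, and these already lie in
    one stage of the chain.\<close>
  then have cons: "\<not> (\<Delta> \<turnstile> \<^bold>\<bottom>)"
    using derives_finite inv weaken by meson
  \<comment> \<open>The formula with code \<open>n\<close> is treated on passing from stage
    \<open>n\<close> to stage \<open>Suc n\<close>.\<close>
  have step: "henkin_step (henkin_chain S (to_nat \<phi>)) \<phi> = henkin_chain S (Suc (to_nat \<phi>))" for \<phi>
    by simp
  have sub: "henkin_chain S n \<subseteq> \<Delta>" for n unfolding \<Delta>_def by blast
  have dec: "\<phi> \<in> \<Delta> \<or> (\<^bold>\<not> \<phi>) \<in> \<Delta>" for \<phi>
    using henkin_step_decides[of \<phi> "henkin_chain S (to_nat \<phi>)"] step sub by blast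
  have "\<exists>t. inst \<phi> t \<in> \<Delta>" if "Ex \<phi> \<in> \<Delta>" for \<phi>
  proof -
    let ?S = "henkin_chain S (to_nat (Ex \<phi>))"
    have "Ex \<phi> \<in> henkin_step ?S (Ex \<phi>)"
    proof (rule ccontr)
      assume "Ex \<phi> \<notin> henkin_step ?S (Ex \<phi>)"
      then have "(\<^bold>\<not> Ex \<phi>) \<in> \<Delta>" using henkin_step_decides[of "Ex \<phi>" ?S] step sub by blast
      then have "\<Delta> \<turnstile> \<^bold>\<bottom>" using that Assm ImpE unfolding Neg_def by blast
      then show False using cons by blast
    qed
    then show ?thesis using henkin_step_witness[of \<phi> ?S] inv step sub by (metis subsetD)
  qed
  then have "henkin \<Delta>" using cons dec unfolding henkin_def by blast
  moreover have "S \<subseteq> \<Delta>" using sub[of 0] by simp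
  ultimately show ?thesis by blast
qed

section \<open>Membership in a Henkin set commutes with the connectives\<close>

lemma henkin_closed: "henkin \<Delta> \<Longrightarrow> (\<Delta> \<turnstile> \<phi>) \<longleftrightarrow> \<phi> \<in> \<Delta>"
  unfolding henkin_def Neg_def using Assm ImpE by blast

lemma henkin_Neg: "henkin \<Delta> \<Longrightarrow> (\<^bold>\<not> \<phi>) \<in> \<Delta> \<longleftrightarrow> \<phi> \<notin> \<Delta>"
  unfolding henkin_def Neg_def using ImpE[OF Assm Assm] by blast

lemma henkin_mem: "henkin \<Delta> \<Longrightarrow> \<Delta> \<turnstile> \<phi> \<Longrightarrow> \<phi> \<in> \<Delta>"
  using henkin_closed by simp

lemma henkin_And: assumes "henkin \<Delta>" shows "(\<phi> \<^bold>\<and> \<psi>) \<in> \<Delta> \<longleftrightarrow> \<phi> \<in> \<Delta> \<and> \<psi> \<in> \<Delta>"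
proof (intro iffI conjI)
  assume *: "(\<phi> \<^bold>\<and> \<psi>) \<in> \<Delta>"
  show "\<phi> \<in> \<Delta>" using henkin_mem[OF assms AndE1[OF Assm[OF *]]] .
  show "\<psi> \<in> \<Delta>" using henkin_mem[OF assms AndE2[OF Assm[OF *]]] .
next
  assume "\<phi> \<in> \<Delta> \<and> \<psi> \<in> \<Delta>"
  then show "(\<phi> \<^bold>\<and> \<psi>) \<in> \<Delta>" using henkin_mem[OF assms AndI[OF Assm Assm]] by simp
qed

lemma henkin_Or: assumes "henkin \<Delta>" shows "(\<phi> \<^bold>\<or> \<psi>) \<in> \<Delta> \<longleftrightarrow> \<phi> \<in> \<Delta> \<or> \<psi> \<in> \<Delta>"
proof
  assume *: "(\<phi> \<^bold>\<or> \<psi>) \<in> \<Delta>"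
  show "\<phi> \<in> \<Delta> \<or> \<psi> \<in> \<Delta>"
  proof (rule ccontr)
    assume "\<not> (\<phi> \<in> \<Delta> \<or> \<psi> \<in> \<Delta>)"
    then have neg: "(\<phi> \<^bold>\<longrightarrow> \<^bold>\<bottom>) \<in> \<Delta>" "(\<psi> \<^bold>\<longrightarrow> \<^bold>\<bottom>) \<in> \<Delta>"
      using henkin_Neg assms unfolding Neg_def by simp_all
    have "\<Delta> \<turnstile> \<^bold>\<bottom>"
    proof (rule OrE[OF Assm[OF *]])
      show "insert \<phi> \<Delta> \<turnstile> \<^bold>\<bottom>" by (rule ImpE[OF Assm Assm, of \<phi>]) (simp_all add: neg)
      show "insert \<psi> \<Delta> \<turnstile> \<^bold>\<bottom>" by (rule ImpE[OF Assm Assm, of \<psi>]) (simp_all add: neg)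
    qed
    then show False using assms unfolding henkin_def by simp
  qed
next
  assume "\<phi> \<in> \<Delta> \<or> \<psi> \<in> \<Delta>"
  then show "(\<phi> \<^bold>\<or> \<psi>) \<in> \<Delta>"
    using henkin_mem[OF assms OrI1[OF Assm]] henkin_mem[OF assms OrI2[OF Assm]] by auto
qed

lemma henkin_Imp: assumes "henkin \<Delta>" shows "(\<phi> \<^bold>\<longrightarrow> \<psi>) \<in> \<Delta> \<longleftrightarrow> (\<phi> \<in> \<Delta> \<longrightarrow> \<psi> \<in> \<Delta>)"
proof (intro iffI impI)
  assume "(\<phi> \<^bold>\<longrightarrow> \<psi>) \<in> \<Delta>" "\<phi> \<in> \<Delta>"
  then show "\<psi> \<in> \<Delta>" using henkin_mem[OF assms ImpE[OF Assm Assm]] by simp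
next
  assume *: "\<phi> \<in> \<Delta> \<longrightarrow> \<psi> \<in> \<Delta>"
  have "insert \<phi> \<Delta> \<turnstile> \<psi>"
  proof (cases "\<phi> \<in> \<Delta>")
    case True then show ?thesis using * by (simp add: Assm)
  next
    case False
    then have neg: "(\<phi> \<^bold>\<longrightarrow> \<^bold>\<bottom>) \<in> \<Delta>" using henkin_Neg assms unfolding Neg_def by simp
    show ?thesis by (rule BotE, rule ImpE[OF Assm Assm, of \<phi>]) (simp_all add: neg)
  qed
  then show "(\<phi> \<^bold>\<longrightarrow> \<psi>) \<in> \<Delta>" by (intro henkin_mem[OF assms] ImpI)
qed

lemma henkin_Ex: assumes "henkin \<Delta>" shows "Ex \<phi> \<in> \<Delta> \<longleftrightarrow> (\<exists>t. inst \<phi> t \<in> \<Delta>)"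
proof
  assume "\<exists>t. inst \<phi> t \<in> \<Delta>"
  then obtain t where "inst \<phi> t \<in> \<Delta>" ..
  then show "Ex \<phi> \<in> \<Delta>" using henkin_mem[OF assms ExI[OF Assm]] by simp
qed (use assms in \<open>simp add: henkin_def\<close>)

section \<open>Negative formulas\<close>

text \<open>Formulas free of disjunction and existence inherit stability under double negation from
  their atoms.\<close>

primrec negative :: "fm \<Rightarrow> bool" where
  "negative \<^bold>\<bottom> = True"
| "negative (a \<^bold>= b) = True"
| "negative (Btw a b c) = True"
| "negative (Cong a b c d) = True"
| "negative (\<phi> \<^bold>\<and> \<psi>) = (negative \<phi> \<and> negative \<psi>)"
| "negative (\<phi> \<^bold>\<or> \<psi>) = False"
| "negative (\<phi> \<^bold>\<longrightarrow> \<psi>) = (negative \<phi> \<and> negative \<psi>)"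
| "negative (All \<phi>) = negative \<phi>"
| "negative (Ex \<phi>) = False"

text \<open>The truth lemma is an equivalence for negative formulas, but only an implication from membership
  to truth for positive ones; the latter suffices for the axioms.\<close>
primrec positive :: "fm \<Rightarrow> bool" where
  "positive \<^bold>\<bottom> = True"
| "positive (a \<^bold>= b) = True"
| "positive (Btw a b c) = True"
| "positive (Cong a b c d) = True"
| "positive (\<phi> \<^bold>\<and> \<psi>) = (positive \<phi> \<and> positive \<psi>)"
| "positive (\<phi> \<^bold>\<or> \<psi>) = (positive \<phi> \<and> positive \<psi>)"
| "positive (\<phi> \<^bold>\<longrightarrow> \<psi>) = (negative \<phi> \<and> positive \<psi>)"
| "positive (All \<phi>) = positive \<phi>"
| "positive (Ex \<phi>) = positive \<phi>"

lemma negative_ren [simp]: "negative (ren f \<phi>) = negative \<phi>"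
  by (induction \<phi> arbitrary: f) auto

lemma ren_Neg [simp]: "ren f (\<^bold>\<not> \<phi>) = (\<^bold>\<not> ren f \<phi>)"
  by (simp add: Neg_def)

lemma ren_Neq [simp]: "ren f (a \<^bold>\<noteq> b) = (f a \<^bold>\<noteq> f b)"
  by (simp add: Neq_def)

lemma ren_T [simp]: "ren f (T a b c) = T (f a) (f b) (f c)"
  by (simp add: T_def)

lemma ren_Col [simp]: "ren f (Col a b c) = Col (f a) (f b) (f c)"
  by (simp add: Col_def)

lemma ren_Right [simp]: "ren f (Right a b c) = Right (f a) (f b) (f c)"
  by (simp add: Right_def)

lemma fv_derived [simp]: "fv (a \<^bold>\<noteq> b) = {a, b}" "fv (T a b c) = {a, b, c}" "fv (Col a b c) = {a, b, c}"
  "fv (Right a b c) = {a, b, c}"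
  by (auto simp: Neq_def T_def Col_def Right_def)

lemma negative_derived [simp]: "negative (\<^bold>\<not> \<phi>) = negative \<phi>" "negative (a \<^bold>\<noteq> b)" "negative (T a b c)"
  "negative (Col a b c)" "negative (Right a b c)"
  by (simp_all add: Neg_def Neq_def T_def Col_def Right_def)

lemma negative_imp_positive: "negative \<phi> \<Longrightarrow> positive \<phi>"
  by (induction \<phi>) auto

lemma positive_Alls: "positive (Alls n \<phi>) = positive \<phi>"
  unfolding Alls_def by (induction n) auto

lemma fv_Alls: "fv (Alls n \<phi>) = {i. i + n \<in> fv \<phi>}"
  unfolding Alls_def by (induction n) auto

section \<open>Instances of the axioms and stability\<close>

lemmas axiom_defs = A1_def A2_def A3_def A4i_def A5_def A6i_def A7i_def A8_def A9_def A10_def A14i_def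
  A15i_def LC2_def Stab_Btw_def Stab_Cong_def Stab_Eq_def

lemma fv_axioms: "\<phi> \<in> intuitionistic_Tarski \<Longrightarrow> fv \<phi> = {}"
  unfolding intuitionistic_Tarski_def by (auto simp: fv_Alls axiom_defs)

lemma ren_closed: "fv \<phi> = {} \<Longrightarrow> ren f \<phi> = \<phi>"
  using ren_cong[of \<phi> f "\<lambda>n. n"] ren_id by simp

lemma ren_axioms: "ren f ` intuitionistic_Tarski = intuitionistic_Tarski"
  using ren_closed[OF fv_axioms] by (auto simp: image_iff)

lemma Alls_inst:
  "\<Gamma> \<turnstile> Alls n \<phi> \<Longrightarrow> \<Gamma> \<turnstile> ren (\<lambda>i. if i < n then f i else i - n) \<phi>"
proof (induction n arbitrary: \<phi> f)
  case 0
  then show ?case by (simp add: Alls_def ren_id)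
next
  case (Suc n)
  \<comment> \<open>The prefix is read as \<open>n\<close> quantifiers around
    \<open>All \<phi>\<close>. The innermost binder owns index \<open>0\<close> and is instantiated
    last, hence the shift of \<open>f\<close>.\<close>
  have "\<Gamma> \<turnstile> Alls n (All \<phi>)" using Suc.prems by (simp add: Alls_def funpow_swap1)
  from AllE[OF Suc.IH[OF this, of "\<lambda>i. f (Suc i)", simplified], of "f 0"]
  show ?case unfolding inst_ren
    by (rule back_subst[of "\<lambda>\<psi>. \<Gamma> \<turnstile> \<psi>"])
      (rule arg_cong[of _ _ "\<lambda>f. ren f \<phi>"], auto simp: fun_eq_iff split: nat.split)
qed

lemma axiom_inst:
  assumes "Alls n \<phi> \<in> intuitionistic_Tarski" "intuitionistic_Tarski \<subseteq> \<Gamma>"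
  shows "\<Gamma> \<turnstile> ren (\<lambda>i. if i < n then xs ! i else i - n) \<phi>"
  using assms by (intro Alls_inst Assm) auto

lemma stab_inst:
  assumes "intuitionistic_Tarski \<subseteq> \<Gamma>"
  shows "\<Gamma> \<turnstile> Stab_Btw a b c" "\<Gamma> \<turnstile> Stab_Cong a b c d" "\<Gamma> \<turnstile> Stab_Eq a b"
  using axiom_inst[OF _ assms, of 3 "Stab_Btw 0 1 2" "[a, b, c]"]
    axiom_inst[OF _ assms, of 4 "Stab_Cong 0 1 2 3" "[a, b, c, d]"]
    axiom_inst[OF _ assms, of 2 "Stab_Eq 0 1" "[a, b]"]
  by (simp_all add: intuitionistic_Tarski_def axiom_defs)

lemma double_Neg_mono:
  assumes "\<Gamma> \<turnstile> \<^bold>\<not> \<^bold>\<not> \<phi>" "insert \<phi> \<Gamma> \<turnstile> \<psi>" shows "\<Gamma> \<turnstile> \<^bold>\<not> \<^bold>\<not> \<psi>"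
proof -
  let ?G = "insert (\<^bold>\<not> \<psi>) \<Gamma>"
  have "insert \<phi> ?G \<turnstile> \<psi>" by (rule weaken[OF assms(2)]) auto
  moreover have "insert \<phi> ?G \<turnstile> \<psi> \<^bold>\<longrightarrow> \<^bold>\<bottom>" by (rule Assm) (simp add: Neg_def)
  ultimately have "insert \<phi> ?G \<turnstile> \<^bold>\<bottom>" using ImpE by blast
  then have "?G \<turnstile> \<^bold>\<not> \<phi>" unfolding Neg_def by (rule ImpI)
  moreover have "?G \<turnstile> \<^bold>\<not> \<phi> \<^bold>\<longrightarrow> \<^bold>\<bottom>" using weaken[OF assms(1), of ?G] unfolding Neg_def[of "\<^bold>\<not> \<phi>"] by auto
  ultimately have "?G \<turnstile> \<^bold>\<bottom>" using ImpE by blast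
  then show ?thesis unfolding Neg_def[of "\<^bold>\<not> \<psi>"] by (rule ImpI)
qed

text \<open>The stability axioms settle the atoms, and a double negation passes inwards through
  conjunction, to the conclusion of an implication, and through the universal quantifier, where the
  axioms survive the shift because they are closed.\<close>

lemma stable_negative:
  "negative \<phi> \<Longrightarrow> intuitionistic_Tarski \<subseteq> \<Gamma> \<Longrightarrow> \<Gamma> \<turnstile> \<^bold>\<not> \<^bold>\<not> \<phi> \<Longrightarrow> \<Gamma> \<turnstile> \<phi>"
proof (induction \<phi> arbitrary: \<Gamma>)
  case Bot
  have "\<Gamma> \<turnstile> \<^bold>\<not> \<^bold>\<bottom>" unfolding Neg_def by (rule ImpI, rule Assm) simp
  then show ?case using Bot.prems(3) ImpE unfolding Neg_def[of "\<^bold>\<not> \<^bold>\<bottom>"] by blast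
next
  case (Eq a b)
  then show ?case using ImpE[OF stab_inst(3)[unfolded Stab_Eq_def]] unfolding Neq_def by blast
next
  case (Btw a b c)
  then show ?case using ImpE[OF stab_inst(1)[unfolded Stab_Btw_def]] by blast
next
  case (Cong a b c d)
  then show ?case using ImpE[OF stab_inst(2)[unfolded Stab_Cong_def]] by blast
next
  case (And \<phi> \<psi>)
  have *: "insert (\<phi> \<^bold>\<and> \<psi>) \<Gamma> \<turnstile> \<phi> \<^bold>\<and> \<psi>" by (rule Assm) simp
  show ?case
    by (rule AndI; rule And.IH) (use And.prems in \<open>auto intro: double_Neg_mono AndE1[OF *] AndE2[OF *]\<close>)
next
  case (Imp \<phi> \<psi>)
  let ?G = "insert \<phi> \<Gamma>"
  have "?G \<turnstile> \<^bold>\<not> \<^bold>\<not> (\<phi> \<^bold>\<longrightarrow> \<psi>)" using weaken Imp.prems by blast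
  moreover have "insert (\<phi> \<^bold>\<longrightarrow> \<psi>) ?G \<turnstile> \<psi>" by (rule ImpE[OF Assm Assm, of \<phi>]) auto
  ultimately have "?G \<turnstile> \<^bold>\<not> \<^bold>\<not> \<psi>" by (rule double_Neg_mono)
  then show ?case using Imp.IH(2)[of ?G] Imp.prems by (intro ImpI) auto
next
  case (All \<phi>)
  let ?G = "ren Suc ` \<Gamma>"
  have "?G \<turnstile> \<^bold>\<not> \<^bold>\<not> ren Suc (All \<phi>)" using derives_ren[OF All.prems(3), of Suc] by simp
  moreover have "insert (ren Suc (All \<phi>)) ?G \<turnstile> \<phi>"
    using AllE[of "insert (ren Suc (All \<phi>)) ?G" "ren (under Suc) \<phi>" 0] Assm
    unfolding inst_shift by simp
  ultimately have "?G \<turnstile> \<^bold>\<not> \<^bold>\<not> \<phi>" by (rule double_Neg_mono)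
  moreover have "intuitionistic_Tarski \<subseteq> ?G"
    using image_mono[OF All.prems(2), of "ren Suc"] unfolding ren_axioms .
  ultimately show ?case using All by (intro AllI) simp
qed auto

text \<open>If all instances are members, \<open>Ex (Neg \<phi>)\<close> has no witness, so its
  negation is a member. This refutes \<open>Neg \<phi>\<close> for an eigenvariable, and stability
  removes the double negation.\<close>

lemma henkin_All:
  assumes "henkin \<Delta>" "intuitionistic_Tarski \<subseteq> \<Delta>" "negative \<phi>"
  shows "All \<phi> \<in> \<Delta> \<longleftrightarrow> (\<forall>t. inst \<phi> t \<in> \<Delta>)"
proof (intro iffI allI)
  fix t assume "All \<phi> \<in> \<Delta>"
  then show "inst \<phi> t \<in> \<Delta>" using henkin_mem[OF assms(1) AllE[OF Assm]] by simp
next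
  assume *: "\<forall>t. inst \<phi> t \<in> \<Delta>"
  have "Ex (\<^bold>\<not> \<phi>) \<notin> \<Delta>"
    using * henkin_Ex[OF assms(1)] henkin_Neg[OF assms(1)] by (auto simp: inst_def)
  then have "(\<^bold>\<not> Ex (\<^bold>\<not> \<phi>)) \<in> \<Delta>" using henkin_Neg[OF assms(1)] by blast
  then have ex: "(\<^bold>\<not> Ex (\<^bold>\<not> ren (under Suc) \<phi>)) \<in> ren Suc ` \<Delta>" by (force simp: image_iff)
  let ?G = "insert (\<^bold>\<not> \<phi>) (ren Suc ` \<Delta>)"
  have "?G \<turnstile> inst (\<^bold>\<not> ren (under Suc) \<phi>) 0"
    by (rule Assm) (simp add: inst_def[of "\<^bold>\<not> _"] inst_def[symmetric] inst_shift)
  then have "?G \<turnstile> Ex (\<^bold>\<not> ren (under Suc) \<phi>)" by (rule ExI)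
  moreover have "?G \<turnstile> Ex (\<^bold>\<not> ren (under Suc) \<phi>) \<^bold>\<longrightarrow> \<^bold>\<bottom>"
    using ex unfolding Neg_def by (intro Assm) simp
  ultimately have "?G \<turnstile> \<^bold>\<bottom>" using ImpE by blast
  then have "ren Suc ` \<Delta> \<turnstile> \<^bold>\<not> \<^bold>\<not> \<phi>" unfolding Neg_def[of "\<^bold>\<not> \<phi>"] by (rule ImpI)
  moreover have "intuitionistic_Tarski \<subseteq> ren Suc ` \<Delta>"
    using image_mono[OF assms(2), of "ren Suc"] unfolding ren_axioms .
  ultimately show "All \<phi> \<in> \<Delta>"
    using stable_negative assms(3) by (intro henkin_mem[OF assms(1)] AllI) blast
qed

section \<open>Completeness for negative formulas\<close>

primrec sem :: "('a \<Rightarrow> 'a \<Rightarrow> 'a \<Rightarrow> bool) \<Rightarrow> ('a \<Rightarrow> 'a \<Rightarrow> 'a \<Rightarrow> 'a \<Rightarrow> bool) \<Rightarrow> (nat \<Rightarrow> 'a) \<Rightarrow> fm \<Rightarrow> bool" where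
  "sem B C e \<^bold>\<bottom> = False"
| "sem B C e (a \<^bold>= b) = (e a = e b)"
| "sem B C e (Btw a b c) = B (e a) (e b) (e c)"
| "sem B C e (Cong a b c d) = C (e a) (e b) (e c) (e d)"
| "sem B C e (\<phi> \<^bold>\<and> \<psi>) = (sem B C e \<phi> \<and> sem B C e \<psi>)"
| "sem B C e (\<phi> \<^bold>\<or> \<psi>) = (sem B C e \<phi> \<or> sem B C e \<psi>)"
| "sem B C e (\<phi> \<^bold>\<longrightarrow> \<psi>) = (sem B C e \<phi> \<longrightarrow> sem B C e \<psi>)"
| "sem B C e (All \<phi>) = (\<forall>x. sem B C (case_nat x e) \<phi>)"
| "sem B C e (Ex \<phi>) = (\<exists>x. sem B C (case_nat x e) \<phi>)"

lemma sem_derived [simp]: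
  "sem B C e (\<^bold>\<not> \<phi>) \<longleftrightarrow> \<not> sem B C e \<phi>"
  "sem B C e (a \<^bold>\<noteq> b) \<longleftrightarrow> e a \<noteq> e b"
  "sem B C e (T a b c) \<longleftrightarrow> between B (e a) (e b) (e c)"
  "sem B C e (Col a b c) \<longleftrightarrow> collinear B (e a) (e b) (e c)"
  by (auto simp: Neg_def Neq_def T_def Col_def between_def collinear_def)

lemma sem_Right [simp]:
  "sem B C e (Right a b c) \<longleftrightarrow> e a \<noteq> e b \<and> e b \<noteq> e c \<and>
    (\<forall>d. B d (e b) (e c) \<and> C d (e b) (e b) (e c) \<longrightarrow> C (e a) d (e a) (e c))"
  by (simp add: Right_def)

lemma sem_Alls: "sem B C e (Alls n \<phi>) \<longleftrightarrow> (\<forall>xs. length xs = n \<longrightarrow> sem B C (\<lambda>i. if i < n then xs ! i else e (i - n)) \<phi>)"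
proof (induction n arbitrary: e)
  case 0
  then show ?case by (simp add: Alls_def)
next
  case (Suc n)
  \<comment> \<open>The outermost quantifier binds the highest index, so its value is appended at
    the end of the list.\<close>
  have eq: "(\<lambda>i. if i < n then xs ! i else case_nat x e (i - n)) =
      (\<lambda>i. if i < Suc n then (xs @ [x]) ! i else e (i - Suc n))" if "length xs = n" for xs :: "'a list" and x
    using that by (auto simp: fun_eq_iff nth_append less_Suc_eq intro!: arg_cong[of _ _ e] split: nat.split)
  have "sem B C e (Alls (Suc n) \<phi>) \<longleftrightarrow> (\<forall>x xs. length xs = n \<longrightarrow>
      sem B C (\<lambda>i. if i < Suc n then (xs @ [x]) ! i else e (i - Suc n)) \<phi>)"
    using Suc eq by (auto simp: Alls_def)
  also have "\<dots> \<longleftrightarrow> (\<forall>ys. length ys = Suc n \<longrightarrow>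
      sem B C (\<lambda>i. if i < Suc n then ys ! i else e (i - Suc n)) \<phi>)"
  proof (intro iffI allI impI)
    fix ys :: "'a list"
    assume *: "\<forall>x xs. length xs = n \<longrightarrow>
      sem B C (\<lambda>i. if i < Suc n then (xs @ [x]) ! i else e (i - Suc n)) \<phi>" "length ys = Suc n"
    then have snoc: "butlast ys @ [last ys] = ys" and "length (butlast ys) = n"
      by (auto intro: append_butlast_last_id)
    then show "sem B C (\<lambda>i. if i < Suc n then ys ! i else e (i - Suc n)) \<phi>"
      using *(1)[rule_format, of "butlast ys" "last ys"] unfolding snoc by blast
  qed simp
  finally show ?case .
qed

lemma tarski_plane_sem:
  assumes "\<And>\<phi> e. \<phi> \<in> intuitionistic_Tarski \<Longrightarrow> sem B C e \<phi>"
  shows "tarski_plane B C"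
proof
  have ax: "sem B C (\<lambda>i. if i < length xs then xs ! i else undefined) \<phi>"
    if "Alls n \<phi> \<in> intuitionistic_Tarski" "length xs = n" for n xs \<phi>
    using assms[OF that(1), of "\<lambda>_. undefined"] that(2) by (simp add: sem_Alls)
  note simps = intuitionistic_Tarski_def axiom_defs
  show "C a b b a" for a b
    using ax[of 2 "A1 0 1" "[a, b]"] by (simp add: simps)
  show "C a b p q \<Longrightarrow> C a b r s \<Longrightarrow> C p q r s" for a b p q r s
    using ax[of 6 "A2 0 1 2 3 4 5" "[a, b, p, q, r, s]"] by (simp add: simps)
  show "C a b c c \<Longrightarrow> a = b" for a b c
    using ax[of 3 "A3 0 1 2" "[a, b, c]"] by (simp add: simps)
  show "q \<noteq> a \<Longrightarrow> \<exists>x. between B q a x \<and> C a x b c" for q a b c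
    using ax[of 4 "A4i 0 1 2 3" "[q, a, b, c]"] by (simp add: simps)
  show "a \<noteq> b \<Longrightarrow> between B a b c \<Longrightarrow> between B a' b' c' \<Longrightarrow> C a b a' b' \<Longrightarrow> C b c b' c' \<Longrightarrow>
      C a d a' d' \<Longrightarrow> C b d b' d' \<Longrightarrow> C c d c' d'" for a b c d a' b' c' d'
    using ax[of 8 "A5 0 1 2 3 4 5 6 7" "[a, b, c, d, a', b', c', d']"] by (simp add: simps)
  show "\<not> B a b a" for a b
    using ax[of 2 "A6i 0 1" "[a, b]"] by (simp add: simps)
  show "B a p c \<Longrightarrow> between B b q c \<Longrightarrow> \<not> collinear B a b c \<Longrightarrow>
      \<exists>x. between B p x b \<and> between B q x a" for a b c p q
    using ax[of 5 "A7i 0 1 2 3 4" "[a, b, c, p, q]"] by (simp add: simps)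
  show "\<exists>a b c. \<not> collinear B a b c"
    using assms[of A8] by (simp add: simps)
  show "a \<noteq> b \<Longrightarrow> C p a p b \<Longrightarrow> C q a q b \<Longrightarrow> C r a r b \<Longrightarrow> collinear B p q r" for a b p q r
    using ax[of 5 "A9 0 1 2 3 4" "[a, b, p, q, r]"] by (simp add: simps)
  show "\<not> collinear B a b c \<Longrightarrow> \<exists>x. C a x b x \<and> C a x c x" for a b c
    using ax[of 3 "A10 0 1 2" "[a, b, c]"] by (simp add: simps)
  show "B a b c \<Longrightarrow> B c b a" for a b c
    using ax[of 3 "A14i 0 1 2" "[a, b, c]"] by (simp add: simps)
  show "B a b d \<Longrightarrow> B b c d \<Longrightarrow> B a b c" for a b c d
    using ax[of 4 "A15i 0 1 2 3" "[a, b, c, d]"] by (simp add: simps)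
qed

section \<open>The structure read off from a Henkin set\<close>

lemma henkin_eq_sym: assumes "henkin \<Delta>" "(a \<^bold>= b) \<in> \<Delta>" shows "(b \<^bold>= a) \<in> \<Delta>"
  using henkin_mem[OF assms(1) EqE[OF Assm[OF assms(2)], of "0 \<^bold>= Suc a"]] EqI by (simp add: inst_def)

lemma henkin_eq_trans: assumes "henkin \<Delta>" "(b \<^bold>= c) \<in> \<Delta>" "(a \<^bold>= b) \<in> \<Delta>" shows "(a \<^bold>= c) \<in> \<Delta>"
  using henkin_mem[OF assms(1) EqE[OF Assm[OF assms(2)], of "Suc a \<^bold>= 0"]] Assm[OF assms(3)]
  by (simp add: inst_def)

lemma henkin_Btw_cong:
  assumes "henkin \<Delta>" "(a \<^bold>= a') \<in> \<Delta>" "(b \<^bold>= b') \<in> \<Delta>" "(c \<^bold>= c') \<in> \<Delta>" "Btw a b c \<in> \<Delta>"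
  shows "Btw a' b' c' \<in> \<Delta>"
proof -
  have "\<Delta> \<turnstile> Btw a' b c"
    using EqE[OF Assm[OF assms(2)], of "Btw 0 (Suc b) (Suc c)"] Assm[OF assms(5)] by (simp add: inst_def)
  then have "\<Delta> \<turnstile> Btw a' b' c"
    using EqE[OF Assm[OF assms(3)], of "Btw (Suc a') 0 (Suc c)"] by (simp add: inst_def)
  then have "\<Delta> \<turnstile> Btw a' b' c'"
    using EqE[OF Assm[OF assms(4)], of "Btw (Suc a') (Suc b') 0"] by (simp add: inst_def)
  then show ?thesis by (rule henkin_mem[OF assms(1)])
qed

lemma henkin_Cong_cong:
  assumes "henkin \<Delta>" "(a \<^bold>= a') \<in> \<Delta>" "(b \<^bold>= b') \<in> \<Delta>" "(c \<^bold>= c') \<in> \<Delta>" "(d \<^bold>= d') \<in> \<Delta>"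
    "Cong a b c d \<in> \<Delta>"
  shows "Cong a' b' c' d' \<in> \<Delta>"
proof -
  have "\<Delta> \<turnstile> Cong a' b c d"
    using EqE[OF Assm[OF assms(2)], of "Cong 0 (Suc b) (Suc c) (Suc d)"] Assm[OF assms(6)]
    by (simp add: inst_def)
  then have "\<Delta> \<turnstile> Cong a' b' c d"
    using EqE[OF Assm[OF assms(3)], of "Cong (Suc a') 0 (Suc c) (Suc d)"] by (simp add: inst_def)
  then have "\<Delta> \<turnstile> Cong a' b' c' d"
    using EqE[OF Assm[OF assms(4)], of "Cong (Suc a') (Suc b') 0 (Suc d)"] by (simp add: inst_def)
  then have "\<Delta> \<turnstile> Cong a' b' c' d'"
    using EqE[OF Assm[OF assms(5)], of "Cong (Suc a') (Suc b') (Suc c') 0"] by (simp add: inst_def)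
  then show ?thesis by (rule henkin_mem[OF assms(1)])
qed

text \<open>The points are the variables, identified when their equation is a member. The quotient
  map \<open>q\<close> is a parameter so that the carrier can be any type of suitable size;
  \<open>small_point\<close> and \<open>nat\<close> will be used.\<close>

lemma henkin_model:
  fixes q :: "nat \<Rightarrow> 'a"
  assumes h: "henkin \<Delta>" and th: "intuitionistic_Tarski \<subseteq> \<Delta>"
    and q: "surj q" "\<And>a b. q a = q b \<longleftrightarrow> (a \<^bold>= b) \<in> \<Delta>"
  shows "\<exists>B C. tarski_plane B C \<and> (\<forall>\<phi> e. negative \<phi> \<longrightarrow> (sem B C (q \<circ> e) \<phi> \<longleftrightarrow> ren e \<phi> \<in> \<Delta>))"
proof -
  define B where "B x y z \<longleftrightarrow> (\<exists>a b c. q a = x \<and> q b = y \<and> q c = z \<and> Btw a b c \<in> \<Delta>)" for x y z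
  define C where "C w x y z \<longleftrightarrow> (\<exists>a b c d. q a = w \<and> q b = x \<and> q c = y \<and> q d = z \<and> Cong a b c d \<in> \<Delta>)"
    for w x y z
  have B: "B (q a) (q b) (q c) \<longleftrightarrow> Btw a b c \<in> \<Delta>" for a b c
    unfolding B_def q(2) using henkin_Btw_cong[OF h] henkin_mem[OF h EqI] by blast
  have C: "C (q a) (q b) (q c) (q d) \<longleftrightarrow> Cong a b c d \<in> \<Delta>" for a b c d
    unfolding C_def q(2) using henkin_Cong_cong[OF h] henkin_mem[OF h EqI] by blast
  have bot: "\<^bold>\<bottom> \<notin> \<Delta>" using h Assm unfolding henkin_def by blast
  have env: "case_nat (q n) (q \<circ> e) = q \<circ> case_nat n e" for n e
    by (auto simp: fun_eq_iff split: nat.split)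
  have ex_q: "\<exists>n. x = q n" for x using q(1) by (metis surjD)
  have neg: "sem B C (q \<circ> e) \<phi> \<longleftrightarrow> ren e \<phi> \<in> \<Delta>" if "negative \<phi>" for \<phi> e
    using that
  proof (induction \<phi> arbitrary: e)
    case (All \<phi>)
    have "sem B C (q \<circ> e) (All \<phi>) \<longleftrightarrow> (\<forall>n. sem B C (q \<circ> case_nat n e) \<phi>)"
      using ex_q by (metis env sem.simps(8))
    also have "\<dots> \<longleftrightarrow> ren e (All \<phi>) \<in> \<Delta>"
      using All henkin_All[OF h th, of "ren (under e) \<phi>"] by (simp add: inst_ren comp_def)
    finally show ?case .
  qed (auto simp: bot q(2) B C henkin_And[OF h] henkin_Imp[OF h])
  have pos: "sem B C (q \<circ> e) \<phi>" if "positive \<phi>" "ren e \<phi> \<in> \<Delta>" for \<phi> e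
    using that
  proof (induction \<phi> arbitrary: e)
    case (All \<phi>)
    have "sem B C (q \<circ> case_nat n e) \<phi>" for n
      using All.IH All.prems henkin_mem[OF h AllE[OF Assm], of "ren (under e) \<phi>" n]
      by (simp add: inst_ren comp_def)
    then show ?case using ex_q by (metis env sem.simps(8))
  next
    case (Ex \<phi>)
    then obtain n where "inst (ren (under e) \<phi>) n \<in> \<Delta>" using henkin_Ex[OF h] by auto
    then have "sem B C (q \<circ> case_nat n e) \<phi>" using Ex by (simp add: inst_ren comp_def)
    then show ?case by (metis env sem.simps(9))
  qed (auto simp: bot q(2) B C henkin_And[OF h] henkin_Imp[OF h] henkin_Or[OF h] neg)
  have "tarski_plane B C"
  proof (rule tarski_plane_sem)
    fix \<phi> and e :: "nat \<Rightarrow> 'a" assume ax: "\<phi> \<in> intuitionistic_Tarski"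
    obtain f where f: "e = q \<circ> f" using ex_q by (metis comp_def ext)
    have "positive \<phi>"
      using ax unfolding intuitionistic_Tarski_def
      by (auto simp: axiom_defs positive_Alls negative_imp_positive)
    moreover have "ren f \<phi> \<in> \<Delta>" using ax th ren_closed[OF fv_axioms] by auto
    ultimately show "sem B C e \<phi>" using pos f by simp
  qed
  then show ?thesis using neg by blast
qed

section \<open>Countermodels on \<open>nat\<close>\<close>

definition eq_class :: "fm set \<Rightarrow> nat \<Rightarrow> nat set" where
  "eq_class \<Delta> a = {b. (a \<^bold>= b) \<in> \<Delta>}"

lemma eq_class_eq: assumes "henkin \<Delta>" shows "eq_class \<Delta> a = eq_class \<Delta> b \<longleftrightarrow> (a \<^bold>= b) \<in> \<Delta>"
proof
  assume "eq_class \<Delta> a = eq_class \<Delta> b"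
  moreover have "(b \<^bold>= b) \<in> \<Delta>" by (rule henkin_mem[OF assms EqI])
  ultimately show "(a \<^bold>= b) \<in> \<Delta>" unfolding eq_class_def by blast
next
  assume ab: "(a \<^bold>= b) \<in> \<Delta>"
  show "eq_class \<Delta> a = eq_class \<Delta> b"
    using henkin_eq_trans[OF assms _ ab] henkin_eq_trans[OF assms _ henkin_eq_sym[OF assms ab]]
    unfolding eq_class_def by blast
qed

text \<open>To get countermodels on \<open>nat\<close> the points of a Henkin set, identified when provably equal, must
  be infinitely many. A putative set with finitely many points is turned into a type, so that the
  infinity of Tarski planes applies to it.\<close>
definition small_henkin :: "fm set" where
  "small_henkin = (SOME \<Delta>. henkin \<Delta> \<and> intuitionistic_Tarski \<subseteq> \<Delta> \<and> finite (range (eq_class \<Delta>)))"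

typedef small_point = "range (eq_class small_henkin)"
  by blast

lemma infinite_eq_classes:
  assumes "henkin \<Delta>" "intuitionistic_Tarski \<subseteq> \<Delta>" shows "infinite (range (eq_class \<Delta>))"
proof
  assume "finite (range (eq_class \<Delta>))"
  with assms have ex: "\<exists>\<Delta>. henkin \<Delta> \<and> intuitionistic_Tarski \<subseteq> \<Delta> \<and> finite (range (eq_class \<Delta>))"
    by blast
  have D: "henkin small_henkin \<and> intuitionistic_Tarski \<subseteq> small_henkin \<and>
      finite (range (eq_class small_henkin))"
    unfolding small_henkin_def by (rule someI_ex[OF ex])
  define q where "q = Abs_small_point \<circ> eq_class small_henkin"
  have "surj q"
    unfolding q_def using type_definition.Abs_image[OF type_definition_small_point]
    by (metis image_comp)
  moreover have "q a = q b \<longleftrightarrow> (a \<^bold>= b) \<in> small_henkin" for a b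
    using eq_class_eq[OF conjunct1[OF D]] Abs_small_point_inject[OF rangeI rangeI]
    by (simp add: q_def)
  ultimately obtain B C where "tarski_plane (B :: small_point \<Rightarrow> _) C"
    using henkin_model D by blast
  then have "infinite (UNIV :: small_point set)" by (rule tarski_plane.infinite_points)
  moreover have "finite (UNIV :: small_point set)"
    using D type_definition.Abs_image[OF type_definition_small_point] by (metis finite_imageI)
  ultimately show False by blast
qed

text \<open>If \<open>\<phi>\<close> is not derivable, stability makes its negation consistent with
  the axioms, and a Henkin extension gives a countermodel. Its countably infinite set of classes is
  moved to \<open>nat\<close>, because a premise can range only over the models on one fixed
  type.\<close>

theorem negative_completeness:
  assumes "negative \<phi>"
    and valid: "\<And>B C (e :: nat \<Rightarrow> nat). tarski_plane B C \<Longrightarrow> sem B C e \<phi>"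
  shows "intuitionistic_Tarski \<turnstile> \<phi>"
proof (rule ccontr)
  assume nd: "\<not> (intuitionistic_Tarski \<turnstile> \<phi>)"
  let ?S = "insert (\<^bold>\<not> \<phi>) intuitionistic_Tarski"
  have "\<not> (?S \<turnstile> \<^bold>\<bottom>)"
  proof
    assume "?S \<turnstile> \<^bold>\<bottom>"
    then have "intuitionistic_Tarski \<turnstile> \<^bold>\<not> \<^bold>\<not> \<phi>" unfolding Neg_def[of "\<^bold>\<not> \<phi>"] by (rule ImpI)
    then show False using stable_negative assms(1) nd by blast
  qed
  moreover have "finite (\<Union> (fv ` ?S))" using fv_axioms finite_fv by simp
  ultimately obtain \<Delta> where \<Delta>: "?S \<subseteq> \<Delta>" "henkin \<Delta>" using ex_henkin by blast
  then have "\<phi> \<notin> \<Delta>" using henkin_Neg by blast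
  define q where "q = to_nat_on (range (eq_class \<Delta>)) \<circ> eq_class \<Delta>"
  have bij: "bij_betw (to_nat_on (range (eq_class \<Delta>))) (range (eq_class \<Delta>)) UNIV"
    using infinite_eq_classes \<Delta> by (intro to_nat_on_infinite) auto
  then have "surj q" unfolding q_def bij_betw_def by (simp add: image_comp)
  moreover have "q a = q b \<longleftrightarrow> (a \<^bold>= b) \<in> \<Delta>" for a b
    using inj_on_eq_iff[OF bij_betw_imp_inj_on[OF bij] rangeI rangeI] eq_class_eq[OF \<Delta>(2)]
    by (simp add: q_def)
  ultimately obtain B C where "tarski_plane B C"
    and sem: "\<forall>\<phi> e. negative \<phi> \<longrightarrow> (sem B C (q \<circ> e) \<phi> \<longleftrightarrow> ren e \<phi> \<in> \<Delta>)"
    using henkin_model[OF \<Delta>(2), of q] \<Delta>(1) by auto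
  then have "ren (\<lambda>n. n) \<phi> \<in> \<Delta>" using valid[of B C "q \<circ> (\<lambda>n. n)"] assms(1) by blast
  then show False using \<open>\<phi> \<notin> \<Delta>\<close> by (simp add: ren_id)
qed

section \<open>Uniform constructions\<close>

lemma under_funpow: "(under ^^ k) f i = (if i < k then i else f (i - k) + k)"
  by (induction k arbitrary: i) (auto simp: under_def split: nat.split)

lemma under_numeral [simp]: "under f (numeral k) = Suc (f (pred_numeral k))"
  by (simp add: numeral_eq_Suc)

lemma ren_Exs: "ren f ((Ex ^^ k) \<phi>) = (Ex ^^ k) (ren ((under ^^ k) f) \<phi>)"
  by (induction k arbitrary: f) (auto simp: funpow_swap1[of under])

lemma fv_Exs: "fv ((Ex ^^ k) \<phi>) = {i. i + k \<in> fv \<phi>}"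
  by (induction k) auto

text \<open>Witnesses are stored from the outermost quantifier inwards in \<open>n\<close>,
  \<open>n + 1\<close> and so on; the innermost one has index \<open>0\<close> and goes to
  \<open>n + k - 1\<close>. These variables are fresh since all free ones lie below
  \<open>n\<close>.\<close>

lemma Exs_fresh:
  assumes "\<Gamma> \<turnstile> (Ex ^^ k) \<phi>" "\<forall>\<psi>\<in>\<Gamma>. fv \<psi> \<subseteq> {..<n}" "fv ((Ex ^^ k) \<phi>) \<subseteq> {..<n}" "fv \<chi> \<subseteq> {..<n}"
    and "insert (ren (\<lambda>i. if i < k then n + k - 1 - i else i - k) \<phi>) \<Gamma> \<turnstile> \<chi>"
  shows "\<Gamma> \<turnstile> \<chi>"
  using assms
proof (induction k arbitrary: n \<Gamma> \<phi>)
  case 0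
  then show ?case using cut[of \<Gamma> \<phi> \<chi>] by (simp add: ren_id)
next
  case (Suc k)
  define \<psi> where "\<psi> = inst ((Ex ^^ k) \<phi>) n"
  have \<psi>: "\<psi> = (Ex ^^ k) (ren ((under ^^ k) (case_nat n (\<lambda>n. n))) \<phi>)"
    unfolding \<psi>_def inst_def ren_Exs ..
  have fv: "fv \<psi> \<subseteq> {..<Suc n}"
    using fv_inst[of "(Ex ^^ k) \<phi>" n] Suc.prems(3) unfolding \<psi>_def by auto
  have "insert \<psi> \<Gamma> \<turnstile> \<chi>"
  proof (rule Suc.IH[of _ _ "Suc n"])
    show "insert \<psi> \<Gamma> \<turnstile> (Ex ^^ k) (ren ((under ^^ k) (case_nat n (\<lambda>n. n))) \<phi>)"
      using \<psi> by (intro Assm) simp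
    show "\<forall>\<psi>'\<in>insert \<psi> \<Gamma>. fv \<psi>' \<subseteq> {..<Suc n}" using Suc.prems(2) fv by force
    show "fv ((Ex ^^ k) (ren ((under ^^ k) (case_nat n (\<lambda>n. n))) \<phi>)) \<subseteq> {..<Suc n}" using fv \<psi> by simp
    show "fv \<chi> \<subseteq> {..<Suc n}" using Suc.prems(4) by auto
    have "ren (\<lambda>i. if i < k then Suc n + k - 1 - i else i - k) (ren ((under ^^ k) (case_nat n (\<lambda>n. n))) \<phi>)
      = ren (\<lambda>i. if i < Suc k then n + Suc k - 1 - i else i - Suc k) \<phi>"
      unfolding ren_ren
      by (rule arg_cong[of _ _ "\<lambda>f. ren f \<phi>"]) (auto simp: fun_eq_iff under_funpow split: nat.split)
    then show "insert (ren (\<lambda>i. if i < k then Suc n + k - 1 - i else i - k)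
        (ren ((under ^^ k) (case_nat n (\<lambda>n. n))) \<phi>)) (insert \<psi> \<Gamma>) \<turnstile> \<chi>"
      using weaken[OF Suc.prems(5)] by (metis insert_mono subset_insertI)
  qed
  then show ?case
    unfolding \<psi>_def by (rule ExE_fresh[rotated]) (use Suc.prems in auto)
qed

text \<open>\<open>reaches\<close> keeps all present knowledge in a single formula, so a new fact
  has to enter as a second conjunct.\<close>

lemma cut_And: assumes "\<Gamma> \<turnstile> \<phi>" "insert (\<phi> \<^bold>\<and> \<psi>) \<Delta> \<turnstile> \<chi>" "\<Delta> \<subseteq> \<Gamma>" shows "insert \<psi> \<Gamma> \<turnstile> \<chi>"
proof (rule cut)
  show "insert \<psi> \<Gamma> \<turnstile> \<phi> \<^bold>\<and> \<psi>"
  proof (rule AndI)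
    show "insert \<psi> \<Gamma> \<turnstile> \<phi>" by (rule weaken[OF assms(1)]) blast
    show "insert \<psi> \<Gamma> \<turnstile> \<psi>" by (rule Assm) simp
  qed
  show "insert (\<phi> \<^bold>\<and> \<psi>) (insert \<psi> \<Gamma>) \<turnstile> \<chi>" by (rule weaken[OF assms(2)]) (use assms(3) in blast)
qed

text \<open>\<open>reaches n S \<chi>\<close>: once points stored in the variables below \<open>n\<close> satisfy \<open>S\<close>, the goal \<open>\<chi>\<close> is
  derivable. Each construction step stores its new points in the variables from \<open>n\<close> on.\<close>
type_synonym condition =
  "(nat \<Rightarrow> nat \<Rightarrow> nat \<Rightarrow> bool) \<Rightarrow> (nat \<Rightarrow> nat \<Rightarrow> nat \<Rightarrow> nat \<Rightarrow> bool) \<Rightarrow> (nat \<Rightarrow> nat) \<Rightarrow> bool"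

definition reaches :: "nat \<Rightarrow> condition \<Rightarrow> fm \<Rightarrow> bool" where
  "reaches n S \<chi> \<longleftrightarrow> (\<forall>\<phi>. negative \<phi> \<longrightarrow> fv \<phi> \<subseteq> {..<n} \<longrightarrow> fv \<chi> \<subseteq> {..<n} \<longrightarrow>
     (\<forall>B C e. tarski_plane B C \<longrightarrow> sem B C e \<phi> \<longrightarrow> S B C e) \<longrightarrow> (insert \<phi> intuitionistic_Tarski \<turnstile> \<chi>))"

section \<open>Construction rules\<close>

lemma reaches_mono:
  assumes "reaches n S' \<chi>" "\<And>B C e. tarski_plane B C \<Longrightarrow> S B C e \<Longrightarrow> S' B C e"
  shows "reaches n S \<chi>"
  using assms unfolding reaches_def by blast

lemma negative_consequence:
  assumes "negative \<phi>" "negative \<psi>"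
    and "\<And>B C (e :: nat \<Rightarrow> nat). tarski_plane B C \<Longrightarrow> sem B C e \<phi> \<Longrightarrow> sem B C e \<psi>"
  shows "insert \<phi> intuitionistic_Tarski \<turnstile> \<psi>"
proof -
  have "intuitionistic_Tarski \<turnstile> \<phi> \<^bold>\<longrightarrow> \<psi>" by (rule negative_completeness) (use assms in auto)
  then have "insert \<phi> intuitionistic_Tarski \<turnstile> \<phi> \<^bold>\<longrightarrow> \<psi>" by (rule weaken) blast
  then show ?thesis by (rule ImpE) (rule Assm, simp)
qed

lemma reaches_final:
  assumes "negative \<psi>" "insert \<psi> intuitionistic_Tarski \<turnstile> \<chi>"
    and "\<And>B C e. tarski_plane B C \<Longrightarrow> S B C e \<Longrightarrow> sem B C e \<psi>"
  shows "reaches n S \<chi>"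
  unfolding reaches_def
proof (intro allI impI)
  fix \<phi> assume \<phi>: "negative \<phi>" "\<forall>B C e. tarski_plane B C \<longrightarrow> sem B C e \<phi> \<longrightarrow> S B C e"
  have "insert \<phi> intuitionistic_Tarski \<turnstile> \<psi>" by (rule negative_consequence) (use assms \<phi> in auto)
  moreover have "insert \<psi> (insert \<phi> intuitionistic_Tarski) \<turnstile> \<chi>" by (rule weaken[OF assms(2)]) blast
  ultimately show "insert \<phi> intuitionistic_Tarski \<turnstile> \<chi>" by (rule cut)
qed

text \<open>The general step: \<open>S\<close> yields the premise \<open>P\<close> by completeness
  for negative formulas, the derived implication supplies the points, and \<open>Q\<close>, read at
  their new indices, joins the condition.\<close>

lemma reaches_Exs:
  assumes "intuitionistic_Tarski \<turnstile> P \<^bold>\<longrightarrow> (Ex ^^ k) Q" "negative P" "negative Q" "fv ((Ex ^^ k) Q) \<subseteq> {..<n}"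
    and pre: "\<And>B C e. tarski_plane B C \<Longrightarrow> S B C e \<Longrightarrow> sem B C e P"
    and post: "reaches (n + k)
      (\<lambda>B C e. S B C e \<and> sem B C e (ren (\<lambda>i. if i < k then n + k - 1 - i else i - k) Q)) \<chi>"
  shows "reaches n S \<chi>"
  unfolding reaches_def
proof (intro allI impI)
  fix \<phi>
  assume \<phi>: "negative \<phi>" "\<forall>B C e. tarski_plane B C \<longrightarrow> sem B C e \<phi> \<longrightarrow> S B C e"
    and fv: "fv \<phi> \<subseteq> {..<n}" "fv \<chi> \<subseteq> {..<n}"
  let ?\<Gamma> = "insert \<phi> intuitionistic_Tarski"
  let ?Q = "ren (\<lambda>i. if i < k then n + k - 1 - i else i - k) Q"
  have "?\<Gamma> \<turnstile> P" by (rule negative_consequence) (use assms \<phi> in auto)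
  then have "?\<Gamma> \<turnstile> (Ex ^^ k) Q" using ImpE[OF weaken[OF assms(1)]] by blast
  then show "?\<Gamma> \<turnstile> \<chi>"
  proof (rule Exs_fresh)
    show "\<forall>\<psi>\<in>?\<Gamma>. fv \<psi> \<subseteq> {..<n}" using fv fv_axioms by simp
    have "fv ?Q \<subseteq> {..<n + k}" unfolding fv_ren
    proof (intro subsetI, elim imageE)
      fix i j assume ij: "j = (if i < k then n + k - 1 - i else i - k)" "i \<in> fv Q"
      have "\<not> i < k \<Longrightarrow> i - k \<in> fv ((Ex ^^ k) Q)" using ij(2) by (simp add: fv_Exs)
      then show "j \<in> {..<n + k}" using assms(4) ij by force
    qed
    moreover have "fv \<phi> \<subseteq> {..<n + k}" "fv \<chi> \<subseteq> {..<n + k}" using fv by (auto intro: less_le_trans)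
    ultimately have "insert (\<phi> \<^bold>\<and> ?Q) intuitionistic_Tarski \<turnstile> \<chi>"
      using post \<phi> assms(3) unfolding reaches_def by simp
    then show "insert ?Q ?\<Gamma> \<turnstile> \<chi>" by (intro cut_And[of ?\<Gamma> \<phi>]) (auto intro: Assm)
  qed (use assms fv in auto)
qed

text \<open>Here and in the next four lemmas an existence axiom becomes a construction step. New
  indices are given by equations so that the rules also apply when the number of stored points is
  written differently.\<close>

lemma reaches_extension:
  assumes "q < n" "a < n" "b < n" "c < n" "m = n + 1"
    and "\<And>B C e. tarski_plane B C \<Longrightarrow> S B C e \<Longrightarrow> e q \<noteq> e a"
    and post: "reaches m (\<lambda>B C e. S B C e \<and> between B (e q) (e a) (e n) \<and> C (e a) (e n) (e b) (e c)) \<chi>"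
  shows "reaches n S \<chi>"
proof (rule reaches_Exs[where k = 1])
  have mem: "Alls 4 (A4i 0 1 2 3) \<in> intuitionistic_Tarski" by (simp add: intuitionistic_Tarski_def)
  show "intuitionistic_Tarski \<turnstile> q \<^bold>\<noteq> a \<^bold>\<longrightarrow> (Ex ^^ 1) (T (q+1) (a+1) 0 \<^bold>\<and> Cong (a+1) 0 (b+1) (c+1))"
    using axiom_inst[OF _ subset_refl, of 4 "A4i 0 1 2 3" "[q, a, b, c]"] mem by (simp add: A4i_def)
qed (use assms in auto)

lemma reaches_pasch:
  assumes "a < n" "b < n" "c < n" "p < n" "q < n" "m = n + 1"
    and "\<And>B C e. tarski_plane B C \<Longrightarrow> S B C e \<Longrightarrow>
      B (e a) (e p) (e c) \<and> between B (e b) (e q) (e c) \<and> \<not> collinear B (e a) (e b) (e c)"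
    and post: "reaches m (\<lambda>B C e. S B C e \<and> between B (e p) (e n) (e b) \<and> between B (e q) (e n) (e a)) \<chi>"
  shows "reaches n S \<chi>"
proof (rule reaches_Exs[where k = 1])
  have mem: "Alls 5 (A7i 0 1 2 3 4) \<in> intuitionistic_Tarski" by (simp add: intuitionistic_Tarski_def)
  show "intuitionistic_Tarski \<turnstile> Btw a p c \<^bold>\<and> T b q c \<^bold>\<and> \<^bold>\<not> Col a b c \<^bold>\<longrightarrow>
     (Ex ^^ 1) (T (p+1) 0 (b+1) \<^bold>\<and> T (q+1) 0 (a+1))"
    using axiom_inst[OF _ subset_refl, of 5 "A7i 0 1 2 3 4" "[a, b, c, p, q]"] mem by (simp add: A7i_def)
qed (use assms in auto)

lemma reaches_circumcentre:
  assumes "a < n" "b < n" "c < n" "m = n + 1"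
    and "\<And>B C e. tarski_plane B C \<Longrightarrow> S B C e \<Longrightarrow> \<not> collinear B (e a) (e b) (e c)"
    and post: "reaches m (\<lambda>B C e. S B C e \<and> C (e a) (e n) (e b) (e n) \<and> C (e a) (e n) (e c) (e n)) \<chi>"
  shows "reaches n S \<chi>"
proof (rule reaches_Exs[where k = 1])
  have mem: "Alls 3 (A10 0 1 2) \<in> intuitionistic_Tarski" by (simp add: intuitionistic_Tarski_def)
  show "intuitionistic_Tarski \<turnstile> \<^bold>\<not> Col a b c \<^bold>\<longrightarrow>
     (Ex ^^ 1) (Cong (a+1) 0 (b+1) 0 \<^bold>\<and> Cong (a+1) 0 (c+1) 0)"
    using axiom_inst[OF _ subset_refl, of 3 "A10 0 1 2" "[a, b, c]"] mem by (simp add: A10_def)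
qed (use assms in auto)

lemma reaches_line_circle:
  assumes "u < n" "v < n" "a < n" "b < n" "p < n" "s = n + 1" "m = n + 2"
    and "\<And>B C e. tarski_plane B C \<Longrightarrow> S B C e \<Longrightarrow>
      collinear B (e u) (e v) (e p) \<and> e u \<noteq> e v \<and> between B (e a) (e p) (e b)"
    and post: "reaches m (\<lambda>B C e. S B C e \<and> collinear B (e u) (e v) (e n) \<and>
      collinear B (e u) (e v) (e s) \<and> C (e a) (e n) (e a) (e b) \<and> C (e a) (e s) (e a) (e b) \<and>
      (e p \<noteq> e b \<longrightarrow> e n \<noteq> e s)) \<chi>"
  shows "reaches n S \<chi>"
proof (rule reaches_Exs[where k = 2])
  have mem: "Alls 5 (LC2 0 1 2 3 4) \<in> intuitionistic_Tarski" by (simp add: intuitionistic_Tarski_def)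
  show "intuitionistic_Tarski \<turnstile> Col u v p \<^bold>\<and> u \<^bold>\<noteq> v \<^bold>\<and> T a p b \<^bold>\<longrightarrow>
     (Ex ^^ 2) (Col (u+2) (v+2) 1 \<^bold>\<and> Col (u+2) (v+2) 0 \<^bold>\<and>
             Cong (a+2) 1 (a+2) (b+2) \<^bold>\<and> Cong (a+2) 0 (a+2) (b+2) \<^bold>\<and>
             T 1 (p+2) 0 \<^bold>\<and> (p+2 \<^bold>\<noteq> b+2 \<^bold>\<longrightarrow> 1 \<^bold>\<noteq> 0))"
    using axiom_inst[OF _ subset_refl, of 5 "LC2 0 1 2 3 4" "[u, v, a, b, p]"] mem by (simp add: LC2_def numeral_2_eq_2)
  \<comment> \<open>Index \<open>1\<close> becomes \<open>n\<close> and index \<open>0\<close>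
    becomes \<open>n + 1\<close>, so \<open>y\<close> is stored before \<open>z\<close>.\<close>
  show "reaches (n + 2) (\<lambda>B C e. S B C e \<and>
    sem B C e (ren (\<lambda>i. if i < 2 then n + 2 - 1 - i else i - 2)
      (Col (u+2) (v+2) 1 \<^bold>\<and> Col (u+2) (v+2) 0 \<^bold>\<and>
             Cong (a+2) 1 (a+2) (b+2) \<^bold>\<and> Cong (a+2) 0 (a+2) (b+2) \<^bold>\<and>
             T 1 (p+2) 0 \<^bold>\<and> (p+2 \<^bold>\<noteq> b+2 \<^bold>\<longrightarrow> 1 \<^bold>\<noteq> 0)))) \<chi>"
    using post unfolding \<open>m = n + 2\<close> \<open>s = n + 1\<close> by (rule reaches_mono) simp
qed (use assms in \<open>auto simp: fv_Exs\<close>)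

lemma reaches_triangle:
  assumes "b = n + 1" "c = n + 2" "m = n + 3"
    and post: "reaches m (\<lambda>B C e. S B C e \<and> \<not> collinear B (e n) (e b) (e c)) \<chi>"
  shows "reaches n S \<chi>"
proof (rule reaches_Exs[where k = 3])
  \<comment> \<open>A8 has no premise; a trivially true implication takes the place of
    \<open>P\<close>.\<close>
  have "insert (\<^bold>\<bottom> \<^bold>\<longrightarrow> \<^bold>\<bottom>) intuitionistic_Tarski \<turnstile> (Ex ^^ 3) (\<^bold>\<not> Col 2 1 0)"
    by (rule Assm) (simp add: intuitionistic_Tarski_def A8_def numeral_3_eq_3)
  then show "intuitionistic_Tarski \<turnstile> (\<^bold>\<bottom> \<^bold>\<longrightarrow> \<^bold>\<bottom>) \<^bold>\<longrightarrow> (Ex ^^ 3) (\<^bold>\<not> Col 2 1 0)" by (rule ImpI)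
qed (use assms in \<open>auto simp: fv_Exs\<close>)

text \<open>The figure of \<open>isosceles_midpoint\<close> as a construction: \<open>n\<close> and
  \<open>n + 1\<close> hold the ends \<open>p'\<close>, \<open>q'\<close> of the lengthened legs,
  \<open>n + 2\<close> the crossing point \<open>r\<close>, and \<open>n + 3\<close> the
  midpoint.\<close>

lemma reaches_isosceles_midpoint:
  assumes "v < n" "p < n" "q < n" "m = n + 3" "k = n + 4"
    and pre: "\<And>B C e. tarski_plane B C \<Longrightarrow> S B C e \<Longrightarrow>
      \<not> collinear B (e v) (e p) (e q) \<and> C (e v) (e p) (e v) (e q)"
    and post: "reaches k (\<lambda>B C e. S B C e \<and> midpoint B C (e m) (e p) (e q)) \<chi>"
  shows "reaches n S \<chi>"
proof -
  let ?S1 = "\<lambda>B C e. S B C e \<and> between B (e v) (e p) (e n) \<and> C (e p) (e n) (e v) (e p)"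
  let ?S2 = "\<lambda>B C e. ?S1 B C e \<and> between B (e v) (e q) (e (n+1)) \<and> C (e q) (e (n+1)) (e v) (e p)"
  let ?S3 = "\<lambda>B C e. ?S2 B C e \<and> between B (e p) (e (n+2)) (e (n+1)) \<and> between B (e q) (e (n+2)) (e n)"
  let ?S4 = "\<lambda>B C e. ?S3 B C e \<and> between B (e p) (e (n+3)) (e q) \<and> between B (e (n+2)) (e (n+3)) (e v)"
  have neq: "e v \<noteq> e p \<and> e v \<noteq> e q \<and> (?S1 B C e \<longrightarrow> e p \<noteq> e n)" if "tarski_plane B C" "S B C e" for B C e
  proof -
    interpret tarski_plane B C by fact
    show ?thesis using pre[OF that] cong_null_iff by (metis col_triv(1,3))
  qed
  \<comment> \<open>The rules work back from the goal, so the last construction is treated first,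
    here and in the later composite constructions.\<close>
  have "reaches (n+4) ?S4 \<chi>"
  proof (rule reaches_mono[OF post[unfolded \<open>k = n + 4\<close> \<open>m = n + 3\<close>]], elim conjE, intro conjI)
    fix B C e assume "tarski_plane B C" "S B C e" and st:
      "between B (e v) (e p) (e n)" "C (e p) (e n) (e v) (e p)"
      "between B (e v) (e q) (e (n+1))" "C (e q) (e (n+1)) (e v) (e p)"
      "between B (e p) (e (n+2)) (e (n+1))" "between B (e q) (e (n+2)) (e n)"
      "between B (e p) (e (n+3)) (e q)" "between B (e (n+2)) (e (n+3)) (e v)"
    interpret tarski_plane B C by fact
    show "midpoint B C (e (n+3)) (e p) (e q)"
      by (rule isosceles_midpoint[OF _ _ st]) (use pre[OF \<open>tarski_plane B C\<close> \<open>S B C e\<close>] in auto)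
  qed
  then have "reaches (n+3) ?S3 \<chi>"
  proof (rule reaches_pasch[where a = v and b = q and c = n and p = p and q = "n+2", rotated -1])
    fix B C e assume "tarski_plane B C" and S: "?S3 B C e"
    then interpret tarski_plane B C by blast
    show "B (e v) (e p) (e n) \<and> between B (e q) (e (n+2)) (e n) \<and> \<not> collinear B (e v) (e q) (e n)"
      using isosceles_pasch_inner[of "e v" "e p" "e q" "e n"] pre[of B C e] neq[of B C e] S
        \<open>tarski_plane B C\<close> by blast
  qed (use assms in auto)
  then have "reaches (n+2) ?S2 \<chi>"
  proof (rule reaches_pasch[where a = n and b = "n+1" and c = v and p = p and q = q, rotated -1])
    fix B C e assume "tarski_plane B C" and S: "?S2 B C e"
    then interpret tarski_plane B C by blast
    show "B (e n) (e p) (e v) \<and> between B (e (n+1)) (e q) (e v) \<and> \<not> collinear B (e n) (e (n+1)) (e v)"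
      using isosceles_pasch_outer[of "e v" "e p" "e q" "e n" "e (n+1)"] pre[of B C e] neq[of B C e] S
        \<open>tarski_plane B C\<close> by blast
  qed (use assms in auto)
  then have "reaches (n+1) ?S1 \<chi>"
    by (rule reaches_extension[rotated -1]) (use assms neq in auto)
  then show ?thesis
    by (rule reaches_extension[rotated -1]) (use assms neq in auto)
qed

text \<open>\<open>Line(v,m)\<close> is the perpendicular bisector of a segment \<open>pq\<close>
  with ends on \<open>Line(a,b)\<close>, and it passes through \<open>x\<close> because
  \<open>x\<close> is equidistant from \<open>p\<close> and \<open>q\<close>. The case
  \<open>x = m\<close> is allowed.\<close>

definition perp_bisector ::
  "('a \<Rightarrow> 'a \<Rightarrow> 'a \<Rightarrow> bool) \<Rightarrow> ('a \<Rightarrow> 'a \<Rightarrow> 'a \<Rightarrow> 'a \<Rightarrow> bool) \<Rightarrow> 'a \<Rightarrow> 'a \<Rightarrow> 'a \<Rightarrow> 'a \<Rightarrow> 'a \<Rightarrow> 'a \<Rightarrow> 'a \<Rightarrow> bool" where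
  "perp_bisector B C a b x v m p q \<longleftrightarrow> p \<noteq> q \<and> collinear B a b p \<and> collinear B a b q \<and>
    C x p x q \<and> C v p v q \<and> midpoint B C m p q \<and> v \<noteq> m"

context tarski_plane
begin

lemma col_on_line: assumes "a \<noteq> b" "col a b c" "col a b d" "col a b e" shows "col c d e"
proof (cases "c = d")
  case False
  have "col c d a" "col c d b" using col_trans[OF assms(1-3)] col_trans'[OF assms(1-3)] col_perm by blast+
  then show ?thesis using col_unique[OF False assms(1)] assms(4) by blast
qed simp

lemma beyond_neq: assumes "v \<noteq> m" "bet v m s" "bet v s w" "C s w v m" shows "w \<noteq> m"
proof -
  have "bet m s w" using bet_inner' assms(2,3) by blast
  moreover have "s \<noteq> w" using assms(1,4) cong_null_iff by blast
  ultimately show ?thesis using bet_identity by blast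
qed

lemma perp_bisector_foot:
  assumes "a \<noteq> b" "perp_bisector B C a b x v m p q"
  shows "col p q a" "col p q b" "col a b m" "col v m x"
proof -
  have *: "p \<noteq> q" "col a b p" "col a b q" "col p q m" "C x p x q" "C v p v q" "mid m p q"
    using assms(2) bet_col col_perm unfolding perp_bisector_def midpoint_def by blast+
  show "col p q a" "col p q b" using col_on_line[OF assms(1) *(2,3)] by simp_all
  show "col a b m" using col_unique[OF assms(1) *(1,2,3,4)] .
  show "col v m x" using bisector_col[OF *(1,5,6,7)] .
qed

text \<open>Supplies the point off \<open>Line(v,m)\<close> with which a perpendicular to that line
  can be constructed in turn.\<close>

lemma perp_bisector_off:
  assumes "perp_bisector B C a b x v m p q" shows "\<not> col v m p"
proof
  assume "col v m p"
  have *: "p \<noteq> q" "C v p v q" "mid m p q" "v \<noteq> m" using assms unfolding perp_bisector_def by auto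
  have "m \<noteq> p" using mid_neq * by blast
  moreover have "col m p v" "col m p q"
    using \<open>col v m p\<close> *(3) bet_col col_perm unfolding midpoint_def by blast+
  ultimately have "col p q v" using col_trans' by blast
  then show False using isosceles_not_col[OF *(1,3,2,4)] by blast
qed

text \<open>A point of the line equidistant from \<open>p\<close> and \<open>q\<close> is their
  midpoint, so an \<open>x\<close> on the line is itself the foot \<open>m\<close>.\<close>

lemma perp_bisector_from_line:
  assumes "perp_bisector B C a b x v m p q" "v \<noteq> m" "a \<noteq> b" "col a b x" shows "mid x p q" "v \<noteq> x"
proof -
  have *: "p \<noteq> q" "col a b p" "col a b q" "C x p x q" "mid m p q"
    using assms(1) unfolding perp_bisector_def by auto
  have "col p x q" using col_on_line[OF assms(3) *(2) assms(4) *(3)] .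
  then show "mid x p q" using col_equidistant_mid *(1,4) cong_left cong_right by metis
  then show "v \<noteq> x" using midpoint_unique *(5) assms(2) by blast
qed

end

lemma reaches_perp_bisector:
  assumes "a < n" "b < n" "c < n" "x < n"
    and new: "p = n + 3" "q = n + 4" "v = n + 6" "m = n + 10" "k = n + 11"
    and pre: "\<And>B C e. tarski_plane B C \<Longrightarrow> S B C e \<Longrightarrow> \<not> collinear B (e a) (e b) (e c)"
    and post: "reaches k (\<lambda>B C e. S B C e \<and>
      perp_bisector B C (e a) (e b) (e x) (e v) (e m) (e p) (e q)) \<chi>"
  shows "reaches n S \<chi>"
proof -
  \<comment> \<open>\<open>n\<close> and \<open>n + 1\<close> lead to a point of the line other than
    \<open>x\<close>, \<open>n + 2\<close> fixes a circle about \<open>x\<close> reaching beyond it,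
    \<open>n + 3\<close> and \<open>n + 4\<close> are its intersections \<open>p\<close>,
    \<open>q\<close> with the line, \<open>n + 5\<close> is the point beyond \<open>p\<close> on the
    line \<open>cp\<close> at distance \<open>pq\<close>, and \<open>n + 6\<close> is the
    circumcentre. The midpoint construction fills \<open>n + 7\<close> to
    \<open>n + 10\<close>.\<close>
  let ?S1 = "\<lambda>B C e. S B C e \<and> between B (e a) (e b) (e n) \<and> C (e b) (e n) (e b) (e x)"
  let ?S2 = "\<lambda>B C e. ?S1 B C e \<and> between B (e a) (e n) (e (n+1)) \<and> C (e n) (e (n+1)) (e a) (e b)"
  let ?S3 = "\<lambda>B C e. ?S2 B C e \<and> between B (e x) (e (n+1)) (e (n+2)) \<and> C (e (n+1)) (e (n+2)) (e a) (e b)"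
  let ?S5 = "\<lambda>B C e. ?S3 B C e \<and> collinear B (e a) (e b) (e (n+3)) \<and>
      collinear B (e a) (e b) (e (n+4)) \<and> C (e x) (e (n+3)) (e x) (e (n+2)) \<and>
      C (e x) (e (n+4)) (e x) (e (n+2)) \<and> (e (n+1) \<noteq> e (n+2) \<longrightarrow> e (n+3) \<noteq> e (n+4))"
  let ?S6 = "\<lambda>B C e. ?S5 B C e \<and> between B (e c) (e (n+3)) (e (n+5)) \<and>
      C (e (n+3)) (e (n+5)) (e (n+3)) (e (n+4))"
  let ?S7 = "\<lambda>B C e. ?S6 B C e \<and> C (e (n+3)) (e (n+6)) (e (n+4)) (e (n+6)) \<and>
      C (e (n+3)) (e (n+6)) (e (n+5)) (e (n+6))"
  let ?S11 = "\<lambda>B C e. ?S7 B C e \<and> midpoint B C (e (n+10)) (e (n+3)) (e (n+4))"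
  have ab: "e a \<noteq> e b" if "tarski_plane B C" "S B C e" for B C e
    using pre[OF that] by (auto simp: collinear_def between_def)
  have ext: "e a \<noteq> e n \<and> collinear B (e a) (e b) (e (n+1)) \<and> e x \<noteq> e (n+1)"
    if "tarski_plane B C" "?S2 B C e" for B C e
  proof -
    interpret tarski_plane B C by fact
    show ?thesis
      using longer_extension[of "e a" "e b" "e n" "e x" "e (n+1)"] bet_trans[of "e a" "e b" "e n" "e (n+1)"]
        bet_identity bet_col ab that by metis
  qed
  have pq: "e (n+3) \<noteq> e (n+4) \<and> e (n+3) \<noteq> e c \<and> C (e x) (e (n+3)) (e x) (e (n+4))"
    if "tarski_plane B C" "?S5 B C e" for B C e
  proof -
    interpret tarski_plane B C by fact
    show ?thesis using that ab[of B C e] pre[of B C e] cong_null_iff cong_euclid cong_sym by metis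
  qed
  have nc: "\<not> collinear B (e (n+3)) (e (n+4)) (e (n+5))" if "tarski_plane B C" "?S6 B C e" for B C e
  proof -
    interpret tarski_plane B C by fact
    have "e (n+3) \<noteq> e (n+5)" using pq[of B C e] that cong_null_iff by metis
    moreover have "collinear B (e c) (e (n+3)) (e (n+5))" using that bet_col by blast
    ultimately show ?thesis
      using that pq[of B C e] pre[of B C e] ab[of B C e] col_unique col_perm by (smt (verit))
  qed
  have ncv: "\<not> collinear B (e (n+6)) (e (n+3)) (e (n+4)) \<and> C (e (n+6)) (e (n+3)) (e (n+6)) (e (n+4))"
    if "tarski_plane B C" "?S7 B C e" for B C e
  proof -
    interpret tarski_plane B C by fact
    show ?thesis
      using circumcentre_not_col[of "e (n+3)" "e (n+4)" "e (n+5)" "e (n+6)"] nc[of B C e] that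
        cong_left cong_right by metis
  qed
  have "reaches (n+11) ?S11 \<chi>"
  proof (rule reaches_mono[OF post[unfolded new]], intro conjI)
    fix B C e assume plane: "tarski_plane B C" and S: "?S11 B C e"
    then interpret tarski_plane B C by blast
    have "e (n+6) \<noteq> e (n+10)"
      using ncv[OF plane] S bet_col col_perm unfolding midpoint_def by metis
    then show "perp_bisector B C (e a) (e b) (e x) (e (n+6)) (e (n+10)) (e (n+3)) (e (n+4))"
      unfolding perp_bisector_def using ncv[OF plane] pq[OF plane] S by blast
  qed blast
  then have "reaches (n+7) ?S7 \<chi>"
  proof (rule reaches_isosceles_midpoint[rotated -1])
    show "\<not> collinear B (e (n+6)) (e (n+3)) (e (n+4)) \<and> C (e (n+6)) (e (n+3)) (e (n+6)) (e (n+4))"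
      if "tarski_plane B C" "?S7 B C e" for B C e
      using ncv[OF that] .
  qed auto
  then have "reaches (n+6) ?S6 \<chi>"
  proof (rule reaches_circumcentre[rotated -1])
    show "\<not> collinear B (e (n+3)) (e (n+4)) (e (n+5))" if "tarski_plane B C" "?S6 B C e" for B C e
      using nc[OF that] .
  qed auto
  then have "reaches (n+5) ?S5 \<chi>"
  proof (rule reaches_extension[rotated -1])
    show "e c \<noteq> e (n+3)" if "tarski_plane B C" "?S5 B C e" for B C e
      using pq[OF that] by metis
  qed (use assms in auto)
  then have "reaches (n+3) ?S3 \<chi>"
    by (rule reaches_line_circle[rotated -1]) (use ab ext assms in auto)
  then have "reaches (n+2) ?S2 \<chi>"
    by (rule reaches_extension[rotated -1]) (use ext assms in auto)
  then have "reaches (n+1) ?S1 \<chi>"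
  proof (rule reaches_extension[rotated -1])
    fix B C e assume plane: "tarski_plane B C" and S: "?S1 B C e"
    then interpret tarski_plane B C by blast
    show "e a \<noteq> e n" using ab[OF plane] S bet_identity by metis
  qed (use assms in auto)
  then show ?thesis
    by (rule reaches_extension[rotated -1]) (use ab assms in auto)
qed

text \<open>The perpendicular through \<open>x\<close> has foot \<open>f\<close>, and
  \<open>x\<close> is reflected in \<open>f\<close> along it by the detour of
  \<open>point_reflection\<close>. This covers an \<open>x\<close> on the axis as well.\<close>

lemma reaches_mirror:
  assumes "a < n" "b < n" "c < n" "x < n" and new: "f = n + 10" "y = n + 15" "k = n + 16"
    and pre: "\<And>B C e. tarski_plane B C \<Longrightarrow> S B C e \<Longrightarrow> \<not> collinear B (e a) (e b) (e c)"
    and post: "reaches k (\<lambda>B C e. S B C e \<and> midpoint B C (e f) (e x) (e y) \<and>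
      collinear B (e a) (e b) (e f) \<and> C (e a) (e x) (e a) (e y) \<and> C (e b) (e x) (e b) (e y)) \<chi>"
  shows "reaches n S \<chi>"
proof -
  let ?f = "n+10" and ?y = "n+15" and ?v = "n+6" and ?s = "n+11" and ?w = "n+12" and ?w' = "n+13" and ?w'' = "n+14"
  let ?S0 = "\<lambda>B C e. S B C e \<and> perp_bisector B C (e a) (e b) (e x) (e ?v) (e ?f) (e (n+3)) (e (n+4))"
  let ?S1 = "\<lambda>B C e. ?S0 B C e \<and> between B (e ?v) (e ?f) (e ?s) \<and> C (e ?f) (e ?s) (e ?f) (e x)"
  let ?S2 = "\<lambda>B C e. ?S1 B C e \<and> between B (e ?v) (e ?s) (e ?w) \<and> C (e ?s) (e ?w) (e ?v) (e ?f)"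
  let ?S3 = "\<lambda>B C e. ?S2 B C e \<and> between B (e ?w) (e ?f) (e ?w') \<and> C (e ?f) (e ?w') (e ?f) (e ?w)"
  let ?S4 = "\<lambda>B C e. ?S3 B C e \<and> between B (e ?w) (e ?w') (e ?w'') \<and> C (e ?w') (e ?w'') (e ?v) (e ?f)"
  let ?S5 = "\<lambda>B C e. ?S4 B C e \<and> between B (e ?w'') (e ?w') (e ?y) \<and> C (e ?w') (e ?y) (e ?w) (e x)"
  have vf: "e ?v \<noteq> e ?f \<and> collinear B (e ?v) (e ?f) (e x)" if "tarski_plane B C" "?S0 B C e" for B C e
  proof -
    interpret tarski_plane B C by fact
    show ?thesis using that bisector_col unfolding perp_bisector_def by blast
  qed
  have "reaches (n+16) ?S5 \<chi>"
  proof (rule reaches_mono[OF post[unfolded new]])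
    fix B C e assume plane: "tarski_plane B C" and S: "?S5 B C e"
    then interpret tarski_plane B C by blast
    have mid: "midpoint B C (e ?f) (e x) (e ?y)"
      using point_reflection(5)[of "e ?v" "e ?f" "e x" "e ?s" "e ?w" "e ?w'" "e ?w''" "e ?y"] vf[OF plane] S
      by blast
    have ab: "e a \<noteq> e b" using pre[OF plane] S col_triv(1) by metis
    have pb: "perp_bisector B C (e a) (e b) (e x) (e ?v) (e ?f) (e (n+3)) (e (n+4))" using S by blast
    note foot = perp_bisector_foot[OF ab pb]
    show "S B C e \<and> midpoint B C (e ?f) (e x) (e ?y) \<and>
      collinear B (e a) (e b) (e ?f) \<and> C (e a) (e x) (e a) (e ?y) \<and> C (e b) (e x) (e b) (e ?y)"
      using mid S pb foot mirror_axis[of "e (n+3)" "e (n+4)" "e x" "e ?f" "e ?y"] unfolding perp_bisector_def by blast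
  qed
  then have "reaches (n+15) ?S4 \<chi>"
  proof (rule reaches_extension[rotated -1])
    fix B C e assume plane: "tarski_plane B C" and S: "?S4 B C e"
    then interpret tarski_plane B C by blast
    show "e ?w'' \<noteq> e ?w'"
      using cong_null_iff vf[OF plane] S by metis
  qed (use new assms in auto)
  then have "reaches (n+14) ?S3 \<chi>"
  proof (rule reaches_extension[rotated -1])
    fix B C e assume plane: "tarski_plane B C" and S: "?S3 B C e"
    then interpret tarski_plane B C by blast
    have "e ?w \<noteq> e ?f" using beyond_neq[of "e ?v" "e ?f" "e ?s" "e ?w"] vf[OF plane] S by blast
    moreover have "bet (e ?w) (e ?f) (e ?w')" using S by blast
    ultimately show "e ?w \<noteq> e ?w'" using bet_identity by metis
  qed (use new assms in auto)
  then have "reaches (n+13) ?S2 \<chi>"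
  proof (rule reaches_extension[rotated -1])
    fix B C e assume plane: "tarski_plane B C" and S: "?S2 B C e"
    then interpret tarski_plane B C by blast
    show "e ?w \<noteq> e ?f" using beyond_neq[of "e ?v" "e ?f" "e ?s" "e ?w"] vf[OF plane] S by blast
  qed (use new assms in auto)
  then have "reaches (n+12) ?S1 \<chi>"
  proof (rule reaches_extension[rotated -1])
    fix B C e assume plane: "tarski_plane B C" and S: "?S1 B C e"
    then interpret tarski_plane B C by blast
    show "e ?v \<noteq> e ?s" using vf[OF plane] S bet_identity by metis
  qed (use new assms in auto)
  then have "reaches (n+11) ?S0 \<chi>"
    by (rule reaches_extension[rotated -1]) (use new assms vf in auto)
  then show ?thesis
    by (rule reaches_perp_bisector[where c = c, rotated -1]) (use assms in auto)
qed

lemma reaches_off_line: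
  assumes "a < n" "b < n" and new: "c = n + 61" "k = n + 62"
    and pre: "\<And>B C e. tarski_plane B C \<Longrightarrow> S B C e \<Longrightarrow> e a \<noteq> e b"
    and post: "reaches k (\<lambda>B C e. S B C e \<and> \<not> collinear B (e a) (e b) (e c)) \<chi>"
  shows "reaches n S \<chi>"
proof -
  \<comment> \<open>The noncollinear triple occupies \<open>n\<close> to \<open>n + 2\<close>. A
    perpendicular \<open>vm\<close> through \<open>b\<close> to one of its sides carries
    \<open>E\<close> and \<open>W\<close> with midpoint \<open>b\<close>; the perpendicular to
    \<open>vm\<close> at \<open>b\<close> carries \<open>N\<close> with \<open>bN = bE\<close>, and
    \<open>d\<close> is the midpoint of \<open>EN\<close>. The mirrors in \<open>EW\<close> and
    \<open>bd\<close> take \<open>a\<close> to \<open>a'\<close> and \<open>a'\<close> to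
    \<open>c\<close>. A perpendicular uses 11 variables, a midpoint 4, a mirror image 16.\<close>
  let ?v = "n+9" and ?m = "n+13" and ?p = "n+6" and ?q = "n+7"
  let ?v2 = "n+20" and ?m2 = "n+24" and ?E = "n+17" and ?W = "n+18" and ?N = "n+25" and ?d = "n+29"
  let ?f = "n+40" and ?a' = "n+45" and ?g = "n+56"
  let ?S1 = "\<lambda>B C e. S B C e \<and> \<not> collinear B (e n) (e (n+1)) (e (n+2))"
  let ?S2 = "\<lambda>B C e. ?S1 B C e \<and> perp_bisector B C (e n) (e (n+1)) (e b) (e ?v) (e ?m) (e ?p) (e ?q)"
  let ?S3 = "\<lambda>B C e. ?S2 B C e \<and> perp_bisector B C (e ?v) (e ?m) (e b) (e ?v2) (e ?m2) (e ?E) (e ?W)"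
  let ?S4 = "\<lambda>B C e. ?S3 B C e \<and> between B (e ?v2) (e b) (e ?N) \<and> C (e b) (e ?N) (e b) (e ?E)"
  let ?S5 = "\<lambda>B C e. ?S4 B C e \<and> midpoint B C (e ?d) (e ?E) (e ?N)"
  let ?S6 = "\<lambda>B C e. ?S5 B C e \<and> midpoint B C (e ?f) (e a) (e ?a') \<and> collinear B (e ?E) (e ?W) (e ?f) \<and>
    C (e ?E) (e a) (e ?E) (e ?a') \<and> C (e ?W) (e a) (e ?W) (e ?a')"
  let ?S7 = "\<lambda>B C e. ?S6 B C e \<and> midpoint B C (e ?g) (e ?a') (e c) \<and> collinear B (e b) (e ?d) (e ?g) \<and>
    C (e b) (e ?a') (e b) (e c) \<and> C (e ?d) (e ?a') (e ?d) (e c)"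
  have nc: "\<not> collinear B (e ?v) (e ?m) (e ?p)" if "tarski_plane B C" "?S2 B C e" for B C e
    using tarski_plane.perp_bisector_off[OF that(1)] that(2) by blast
  have m2: "midpoint B C (e b) (e ?E) (e ?W) \<and> e ?v2 \<noteq> e b \<and> e ?E \<noteq> e ?W \<and> C (e ?v2) (e ?E) (e ?v2) (e ?W)"
    if "tarski_plane B C" "?S3 B C e" for B C e
  proof -
    interpret tarski_plane B C by fact
    have pb: "perp_bisector B C (e n) (e (n+1)) (e b) (e ?v) (e ?m) (e ?p) (e ?q)"
      "perp_bisector B C (e ?v) (e ?m) (e b) (e ?v2) (e ?m2) (e ?E) (e ?W)" and "\<not> col (e n) (e (n+1)) (e (n+2))"
      using that by blast+
    then have "e n \<noteq> e (n+1)" by auto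
    then have "col (e ?v) (e ?m) (e b)" using perp_bisector_foot(4) pb(1) by blast
    then show ?thesis
      using pb perp_bisector_from_line[OF pb(2)] unfolding perp_bisector_def by blast
  qed
  have sq: "\<not> collinear B (e ?E) (e ?W) (e ?N) \<and> C (e b) (e ?E) (e b) (e ?N) \<and>
     C (e ?N) (e ?E) (e ?N) (e ?W) \<and> \<not> collinear B (e b) (e ?E) (e ?N)"
    if "tarski_plane B C" "?S4 B C e" for B C e
  proof -
    interpret tarski_plane B C by fact
    show ?thesis
      using that square_frame[of "e ?E" "e ?W" "e b" "e ?v2" "e ?N"] m2[of B C e] by blast
  qed
  have "reaches (n+62) ?S7 \<chi>"
  proof (rule reaches_mono[OF post[unfolded \<open>k = n + 62\<close>]])
    fix B C e assume plane: "tarski_plane B C" and S: "?S7 B C e"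
    then interpret tarski_plane B C by blast
    show "S B C e \<and> \<not> collinear B (e a) (e b) (e c)"
      using double_mirror_not_col[of "e a" "e b" "e ?E" "e ?W" "e ?N" "e ?d" "e ?f" "e ?a'" "e ?g" "e c"]
        S pre[OF plane] sq[OF plane] m2[OF plane] by blast
  qed
  then have "reaches (n+46) ?S6 \<chi>"
  proof (rule reaches_mirror[where c = ?E, rotated -1])
    fix B C e assume plane: "tarski_plane B C" and S: "?S6 B C e"
    then interpret tarski_plane B C by blast
    show "\<not> collinear B (e b) (e ?d) (e ?E)"
      using midpoint_off_side[of "e b" "e ?E" "e ?N" "e ?d"] S sq[OF plane] by blast
  qed (use new assms in auto)
  then have "reaches (n+30) ?S5 \<chi>"
    by (rule reaches_mirror[where c = ?N, rotated -1]) (use sq assms in auto)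
  then have "reaches (n+26) ?S4 \<chi>"
    by (rule reaches_isosceles_midpoint[where v = b, rotated -1]) (use sq assms in auto)
  then have "reaches (n+25) ?S3 \<chi>"
    by (rule reaches_extension[rotated -1]) (use m2 assms in auto)
  then have "reaches (n+14) ?S2 \<chi>"
    by (rule reaches_perp_bisector[where c = ?p, rotated -1]) (use nc assms in auto)
  then have "reaches (n+3) ?S1 \<chi>"
    by (rule reaches_perp_bisector[where c = "n+2", rotated -1]) (use assms in auto)
  then show ?thesis
    by (rule reaches_triangle[rotated -1]) auto
qed

section \<open>Assembling the perpendicular line\<close>

lemma ren_Perp [simp]: "ren f (Perp p q r s) = Perp (f p) (f q) (f r) (f s)"
  by (simp add: Perp_def Perp_at_def)

lemma Perp_I:
  assumes "\<Gamma> \<turnstile> Col p q f" "\<Gamma> \<turnstile> Col r s f"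
    and kl: "\<Gamma> \<turnstile> k \<^bold>\<noteq> f \<^bold>\<and> Col p q k \<^bold>\<and> l \<^bold>\<noteq> f \<^bold>\<and> Col r s l \<^bold>\<and> Right k f l"
  shows "\<Gamma> \<turnstile> Perp p q r s"
proof -
  have "\<Gamma> \<turnstile> inst (k+1 \<^bold>\<noteq> f+1 \<^bold>\<and> Col (p+1) (q+1) (k+1) \<^bold>\<and> 0 \<^bold>\<noteq> f+1 \<^bold>\<and> Col (r+1) (s+1) 0 \<^bold>\<and> Right (k+1) (f+1) 0) l"
    using kl by (simp add: inst_def)
  then have "\<Gamma> \<turnstile> inst (Ex (1 \<^bold>\<noteq> f+2 \<^bold>\<and> Col (p+2) (q+2) 1 \<^bold>\<and> 0 \<^bold>\<noteq> f+2 \<^bold>\<and> Col (r+2) (s+2) 0 \<^bold>\<and> Right 1 (f+2) 0)) k"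
    unfolding inst_def[of _ k] by (auto dest: ExI)
  then have "\<Gamma> \<turnstile> inst (Perp_at (p+1) (q+1) (r+1) (s+1) 0) f"
    using assms(1,2) unfolding Perp_at_def inst_def[of _ f] by (auto intro!: AndI dest: ExI)
  then show ?thesis unfolding Perp_def by (rule ExI)
qed

lemma perpendicular_line_I:
  assumes "\<Gamma> \<turnstile> v \<^bold>\<noteq> m" "\<Gamma> \<turnstile> Col v m 0" "\<Gamma> \<turnstile> Perp v m 2 1"
  shows "\<Gamma> \<turnstile> Ex (Ex (1 \<^bold>\<noteq> 0 \<^bold>\<and> Col 1 0 2 \<^bold>\<and> Perp 1 0 4 3))"
proof -
  have "\<Gamma> \<turnstile> inst (v+1 \<^bold>\<noteq> 0 \<^bold>\<and> Col (v+1) 0 1 \<^bold>\<and> Perp (v+1) 0 3 2) m"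
    using assms by (simp add: inst_def AndI)
  then have "\<Gamma> \<turnstile> inst (Ex (1 \<^bold>\<noteq> 0 \<^bold>\<and> Col 1 0 2 \<^bold>\<and> Perp 1 0 4 3)) v"
    unfolding inst_def[of _ v] by (auto dest: ExI simp: numeral_2_eq_2 numeral_3_eq_3)
  then show ?thesis by (rule ExI)
qed

(* Bound variables: a, b, x are 2, 1, 0 and, inside the existentials over p and q,
   a, b, x, p, q are 4, 3, 2, 1, 0. *)
theorem theorem10p1:
  "intuitionistic_Tarski \<turnstile>
     All (All (All (2 \<^bold>\<noteq> 1 \<^bold>\<longrightarrow>
       Ex (Ex (1 \<^bold>\<noteq> 0 \<^bold>\<and> Col 1 0 2 \<^bold>\<and> Perp 1 0 4 3)))))"
proof -
  let ?\<chi> = "Ex (Ex (1 \<^bold>\<noteq> 0 \<^bold>\<and> Col 1 0 2 \<^bold>\<and> Perp 1 0 4 3))"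
  \<comment> \<open>The variables \<open>2\<close>, \<open>1\<close>, \<open>0\<close> hold
    \<open>a\<close>, \<open>b\<close>, \<open>x\<close>. Started at \<open>3\<close>,
    \<open>reaches_off_line\<close> leaves its point in \<open>64\<close>; started at
    \<open>65\<close>, \<open>reaches_perp_bisector\<close> fixes the other indices.\<close>
  let ?c = "3 + 61" and ?v = "65 + 6" and ?m = "65 + 10" and ?p = "65 + 3" and ?q = "65 + 4 :: nat"
  let ?S = "\<lambda>B C e. e 2 \<noteq> e 1"
  let ?S1 = "\<lambda>B C e. ?S B C e \<and> \<not> collinear B (e 2) (e 1) (e ?c)"
  let ?S2 = "\<lambda>B C e. ?S1 B C e \<and> perp_bisector B C (e 2) (e 1) (e 0) (e ?v) (e ?m) (e ?p) (e ?q)"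
  \<comment> \<open>One negative formula collects all that the goal requires: the new line is
    \<open>Line(v,m)\<close>, the foot is \<open>m\<close>, and the right angle is witnessed by
    \<open>v\<close> and \<open>p\<close>.\<close>
  let ?R = "?v \<^bold>\<noteq> ?m \<^bold>\<and> Col ?v ?m 0 \<^bold>\<and> Col ?v ?m ?m \<^bold>\<and> Col ?v ?m ?v \<^bold>\<and> Col 2 1 ?m \<^bold>\<and> ?p \<^bold>\<noteq> ?m \<^bold>\<and>
    Col 2 1 ?p \<^bold>\<and> Right ?v ?m ?p"
  have fin: "insert ?R intuitionistic_Tarski \<turnstile> ?\<chi>"
  proof -
    let ?\<Gamma> = "insert ?R intuitionistic_Tarski"
    have "?\<Gamma> \<turnstile> Perp ?v ?m 2 1"
      by (rule Perp_I[where f = ?m and k = ?v and l = ?p]; rule negative_consequence) auto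
    then show ?thesis
      by (rule perpendicular_line_I[rotated 2]; intro negative_consequence) auto
  qed
  have "reaches 76 ?S2 ?\<chi>"
  proof (rule reaches_final[OF _ fin])
    fix B C and e :: "nat \<Rightarrow> nat" assume plane: "tarski_plane B C" and S: "?S2 B C e"
    then interpret tarski_plane B C by blast
    have pb: "perp_bisector B C (e 2) (e 1) (e 0) (e ?v) (e ?m) (e ?p) (e ?q)" and "e 2 \<noteq> e 1"
      using S by blast+
    note foot = perp_bisector_foot(3,4)[OF this(2,1)]
    have *: "e ?p \<noteq> e ?q" "col (e 2) (e 1) (e ?p)" "C (e ?v) (e ?p) (e ?v) (e ?q)"
      "mid (e ?m) (e ?p) (e ?q)" "e ?v \<noteq> e ?m"
      using pb unfolding perp_bisector_def by blast+
    have "e ?p \<noteq> e ?m" using mid_neq * by metis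
    \<comment> \<open>The point opposite to \<open>p\<close> at equal distance from \<open>m\<close>
      is \<open>q\<close>, and \<open>v\<close> is equidistant from \<open>p\<close> and
      \<open>q\<close>.\<close>
    moreover have "C (e ?v) d (e ?v) (e ?p)" if "B d (e ?m) (e ?p)" "C d (e ?m) (e ?m) (e ?p)" for d
    proof -
      have "mid (e ?m) (e ?p) d"
        using that bet_sym cong_rules unfolding midpoint_def between_def by meson
      then have "d = e ?q" using reflection_unique *(4) by blast
      then show ?thesis using *(3) cong_sym by blast
    qed
    ultimately show "sem B C e ?R" using * foot by auto
  qed simp
  then have "reaches 65 ?S1 ?\<chi>"
    by (rule reaches_perp_bisector[where c = ?c, rotated -1]) auto
  then have "reaches 3 ?S ?\<chi>"
    by (rule reaches_off_line[rotated -1]) auto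
  \<comment> \<open>The starting condition is exactly the hypothesis on \<open>a\<close> and
    \<open>b\<close>, which therefore serves as the formula of \<open>reaches\<close>.\<close>
  then have "insert (2 \<^bold>\<noteq> 1) intuitionistic_Tarski \<turnstile> ?\<chi>"
    unfolding reaches_def by (elim allE[of _ "2 \<^bold>\<noteq> 1"]) (auto simp: Perp_def Perp_at_def)
  then have "intuitionistic_Tarski \<turnstile> 2 \<^bold>\<noteq> 1 \<^bold>\<longrightarrow> ?\<chi>" by (rule ImpI)
  then show ?thesis by (intro AllI) (simp add: ren_axioms)
qed

end
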